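(* Let $\psi:\mathbb{N}\to\mathbb{R}_{\geq 0}$ be decreasing and suppose there exist $\varepsilon>0$, an integer $k\geq 2$, and a constant $c>0$ such that $$\psi(q)\geq c\,\frac{\big(\log^{(k)} q\big)^{\varepsilon}}{q\sqrt{\log q}}\qquad\text{for all } q\in\mathbb{N}.$$ Then for every sequence $\gamma=(\gamma_q)_{q\geq1}$ of real numbers, $\mathrm{m}(W(\psi,\gamma))=1$. In particular, this conclusion holds for $\psi(q)=1/q$.
   Context: $\mathbb{N}=\{1,2,3,\dots\}$. "Decreasing" means $\psi(q+1)\leq\psi(q)$ for all $q$. $\|x\|$ denotes the distance from $x\in\mathbb{R}$ to the nearest integer, and $\mathrm{m}$ is Lebesgue measure. For a sequence $\gamma=(\gamma_q)_{q\ge1}$ of real numbers and $\psi:\mathbb{N}\to\mathbb{R}_{\geq 0}$, $$W(\psi,\gamma)=\{\alpha\in[0,1] : \|q\alpha-\gamma_q\|<\psi(q)\text{ for infinitely many } q\in\mathbb{N}\}.$$ Throughout, $\log x$ means $\max\{1,\ln x\}$, where $\ln$ is the natural logarithm, and $\log^{(k)}$ denotes the $k$-fold iterate of this function $\log$. *)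

theory Defs
  imports "HOL-Analysis.Analysis"
begin

(* Sequences on {1,2,3,...} are functions on nat whose value at 0 is never used. *)

definition dist_int :: "real \<Rightarrow> real" where
  "dist_int x = infdist x \<int>"

definition W :: "(nat \<Rightarrow> real) \<Rightarrow> (nat \<Rightarrow> real) \<Rightarrow> real set" where
  "W \<psi> \<gamma> = {\<alpha> \<in> {0..1}. infinite {q. 1 \<le> q \<and> dist_int (real q * \<alpha> - \<gamma> q) < \<psi> q}}"

definition tlog :: "real \<Rightarrow> real" where
  "tlog x = max 1 (ln x)"

end

theory Submission
  imports Defs
    "HOL-Computational_Algebra.Squarefree"
    "HOL-Number_Theory.Cong"
    "HOL-Probability.Probability_Measure"
    "HOL-Real_Asymp.Real_Asymp"
begin

text \<open>Iterated logarithms are at least 1, so $\psi(q) \ge c / (q \sqrt{\log q})$. Let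
  $A_q$ be the set of $\alpha \in [0,1)$ with $\|q\alpha - \gamma_q\| < \psi(q)$. For arbitrary $\gamma$ one has
  $m(A_q \cap A_r) \le 4 \psi(q) \psi(r) + 2 \gcd(q,r) \psi(q)/q$, and the gcd terms, summed over all $r \le q \le N$,
  are too large. They become harmless for the random variable $\sum_{q \le N} w(q) 1_{A_q}$ with
  $w(q) = 2^{-\Omega(q)}$ on squarefree $q$: taking $\psi(q) = c / (q \sqrt{\ln N})$, its mean is bounded below because
  $\sum_{q \le N} w(q)/q$ has order $\sqrt{\ln N}$, while its variance is at most a constant times
  $(\ln N)^{-1/4} \ln \ln N$. By Chebyshev's inequality almost every $\alpha$ lies in
  some $A_q$ with $q \ge n_0$, for every $n_0$.\<close>

subsection \<open>Chebyshev's upper bound\<close>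

text \<open>Why unit weights fail: with L = ln N and radii c / (q sqrt L), the squared mean has
  order L, while gcd(q, r) averages to order ln q over r <= q and over q, so that the gcd terms
  reach order L^(3/2). The excess comes from integers with many divisors, which the weight damps.
  The base 1/2 is the balance point. With z^Omega(q) instead, heuristically the ratio of the gcd
  terms to the squared mean is L to the power z^2 - 1/2 for z > 1/2 and z^2 - 2z + 1/2 for z < 1/2.
  The best exponent, -1/4, occurs at z = 1/2, where a factor ln L joins it. The same base makes the
  weight almost a convolution square root of 1, so that its sums reduce to harmonic sums. Prime
  number estimates enter through the mean value of the weights: the trivial bound for it is too
  large by a factor ln N, and Chebyshev's bound recovers that factor. The ratio tends to 0 and does
  not merely stay bounded, which is why full and not just positive measure results.\<close>

lemma prod_primes_dvd:
  fixes n :: nat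
  assumes "finite S" "\<And>p. p \<in> S \<Longrightarrow> prime p" "\<And>p. p \<in> S \<Longrightarrow> p dvd n"
  shows "\<Prod>S dvd n"
  using assms
proof (induction S rule: finite_induct)
  case (insert p S)
  have "coprime p (\<Prod>S)"
    by (rule prod_coprime_right) (use insert in \<open>auto intro!: primes_coprime\<close>)
  then have "p * \<Prod>S dvd n" using insert by (intro divides_mult) auto
  then show ?case using insert by simp
qed simp

text \<open>Erdos' argument: for n = 2 m + 1 every prime in (m + 1, 2 m + 1] divides the binomial
  coefficient of 2 m + 1 over m, which is at most 4^m, and the primes up to m + 1 are covered by
  induction. An even n > 2 is not prime and reduces to n - 1.\<close>

lemma primorial_le: "\<Prod>{p. prime p \<and> p \<le> n} \<le> (4::nat) ^ n"
proof (induction n rule: less_induct)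
  case (less n)
  have fin: "finite {p. prime p \<and> p \<le> (m::nat)}" for m by (rule finite_subset[of _ "{..m}"]) auto
  consider "n \<le> 1" | "n = 2" | "n > 2" "even n" | "n > 2" "odd n" by linarith
  then show ?case
  proof cases
    case 1
    then have empty: "{p. prime p \<and> p \<le> n} = {}"
      by (auto dest: prime_gt_1_nat)
    show ?thesis unfolding empty by simp
  next
    case 2
    then have "{p. prime p \<and> p \<le> n} = {2}"
      using two_is_prime_nat by (auto dest: prime_ge_2_nat simp del: two_is_prime_nat)
    then show ?thesis using 2 by simp
  next
    case 3
    then have "\<not> prime n" using prime_odd_nat by auto
    have "p \<le> n - 1" if "prime p" "p \<le> n" for p
    proof -
      have "p \<noteq> n" using that \<open>\<not> prime n\<close> by blast
      then show ?thesis using that by linarith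
    qed
    then have "{p. prime p \<and> p \<le> n} = {p. prime p \<and> p \<le> n - 1}"
      by auto
    moreover have "\<Prod>{p. prime p \<and> p \<le> n - 1} \<le> (4::nat) ^ (n - 1)"
      using less[of "n - 1"] 3 by simp
    moreover have "(4::nat) ^ (n - 1) \<le> 4 ^ n" by (rule power_increasing) auto
    ultimately show ?thesis by (metis order.trans)
  next
    case 4
    define m where "m = n div 2"
    have m: "n = 2 * m + 1" "m \<ge> 1" using 4 by (auto simp: m_def)
    let ?S = "{p. prime p \<and> m + 1 < p \<and> p \<le> 2 * m + 1}"
    have finS: "finite ?S" by (rule finite_subset[of _ "{..2 * m + 1}"]) auto
    have "p dvd (2 * m + 1) choose m" if "p \<in> ?S" for p
    proof -
      have eq: "fact m * fact (m + 1) * ((2 * m + 1) choose m) = (fact (2 * m + 1) :: nat)"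
        using binomial_fact_lemma[of m "2 * m + 1"] by simp
      have "p dvd fact (2 * m + 1)" using that by (simp add: prime_dvd_fact_iff del: fact_Suc)
      then have "p dvd fact m * fact (m + 1) * ((2 * m + 1) choose m)" by (simp only: eq)
      moreover have "\<not> p dvd fact m" "\<not> p dvd fact (m + 1)"
        using that by (auto simp: prime_dvd_fact_iff simp del: fact_Suc)
      ultimately show ?thesis using that by (auto simp: prime_dvd_mult_iff simp del: fact_Suc)
    qed
    then have "\<Prod>?S dvd (2 * m + 1) choose m" by (intro prod_primes_dvd finS) auto
    then have 1: "\<Prod>?S \<le> (2 * m + 1) choose m" by (rule dvd_imp_le) simp
    \<comment> \<open>By symmetry the lower half of row 2 m + 1 sums to 2^(2 m).\<close>
    have "(2 * m + 1) choose m \<le> (\<Sum>k\<le>m. (2 * m + 1) choose k)"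
      by (rule member_le_sum) auto
    then have 2: "(2 * m + 1) choose m \<le> 4 ^ m"
      by (simp only: binomial_r_part_sum) (simp add: power_mult)
    have "{p. prime p \<and> p \<le> n} = {p. prime p \<and> p \<le> m + 1} \<union> ?S" using m by auto
    then have "\<Prod>{p. prime p \<and> p \<le> n} = \<Prod>{p. prime p \<and> p \<le> m + 1} * \<Prod>?S"
      using fin[of "m + 1"] finS by (simp only:) (rule prod.union_disjoint, auto)
    also have "\<dots> \<le> 4 ^ (m + 1) * 4 ^ m"
      by (rule mult_mono) (use less[of "m + 1"] m 1 2 in auto)
    also have "\<dots> = 4 ^ n" using m by (simp add: power_add[symmetric] mult_2)
    finally show ?thesis .
  qed
qed

text \<open>The logarithm of \<open>primorial_le\<close>. Summing over all a with an
  \<open>if\<close> lets this serve as the inner sum of a rearranged divisor sum.\<close>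

lemma chebyshev_theta_le: "(\<Sum>a=1..n. if prime a then ln (real a) else 0) \<le> real n * ln 4"
proof -
  let ?P = "{p. prime p \<and> p \<le> n}"
  have fin: "finite ?P" by (rule finite_subset[of _ "{..n}"]) auto
  have "(\<Sum>a=1..n. if prime a then ln (real a) else 0) = (\<Sum>a\<in>?P. ln (real a))"
    by (rule sum.mono_neutral_cong_right) (auto dest: prime_gt_0_nat intro: Suc_leI)
  also have "\<dots> = ln (real (\<Prod>?P))"
    by (subst of_nat_prod, subst ln_prod[OF fin]) (auto dest: prime_gt_0_nat)
  also have "\<dots> \<le> ln (4 ^ n)"
  proof (rule ln_mono)
    show "real (\<Prod>?P) \<le> 4 ^ n" using primorial_le[of n] by (metis of_nat_le_iff of_nat_numeral of_nat_power)
    show "0 < real (\<Prod>?P)" using fin by (auto intro!: prod_pos dest: prime_gt_0_nat simp: of_nat_prod[symmetric] simp del: of_nat_prod)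
  qed
  finally show ?thesis by (simp add: ln_realpow)
qed

subsection \<open>Weights supported on squarefree numbers\<close>

text \<open>Pairs (n, d) with d dvd n correspond to lattice points (a, b) = (d, n div d) under the
  hyperbola a b <= N. Later bounds compare this region with boxes.\<close>

lemma sum_divisors:
  fixes g :: "nat \<Rightarrow> nat \<Rightarrow> real"
  shows "(\<Sum>n=1..N. \<Sum>d | d dvd n. g d (n div d)) = (\<Sum>a=1..N. \<Sum>b=1..N div a. g a b)"
proof -
  have "(\<Sum>n=1..N. \<Sum>d | d dvd n. g d (n div d))
      = (\<Sum>(n, d)\<in>Sigma {1..N} (\<lambda>n. {d. d dvd n}). g d (n div d))"
    by (rule sum.Sigma) auto
  also have "\<dots> = (\<Sum>(a, b)\<in>Sigma {1..N} (\<lambda>a. {1..N div a}). g a b)"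
  proof (rule sum.reindex_bij_witness[of _ "\<lambda>(a, b). (a * b, a)" "\<lambda>(n, d). (d, n div d)"], goal_cases)
    case (2 x)
    then obtain n d where x: "x = (n, d)" "1 \<le> n" "n \<le> N" "d dvd n" by auto
    then obtain e where e: "n = d * e" by (elim dvdE)
    then have "d \<ge> 1" "e \<ge> 1" using x by (auto simp: Suc_le_eq)
    moreover have "d \<le> N" using x dvd_imp_le[of d n] by simp
    moreover have "e \<le> N div d" using x(3) \<open>d \<ge> 1\<close> unfolding e
      by (subst less_eq_div_iff_mult_less_eq) (simp_all add: mult.commute)
    ultimately show ?case using x(1) e by simp
  next
    case (4 x)
    then obtain a b where x: "x = (a, b)" "1 \<le> a" "a \<le> N" "1 \<le> b" "b \<le> N div a" by auto
    then have "b * a \<le> N" by (subst (asm) less_eq_div_iff_mult_less_eq) simp_all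
    then have "a * b \<le> N" by (simp only: mult.commute)
    then show ?case using x by (simp add: Suc_le_eq)
  next
    case (3 x)
    then show ?case by (cases x) simp
  qed auto
  also have "\<dots> = (\<Sum>a=1..N. \<Sum>b=1..N div a. g a b)"
    by (rule sum.Sigma[symmetric]) auto
  finally show ?thesis .
qed

text \<open>Since $\sum_{ab=n} 2^{-\Omega(a)-\Omega(b)} = \tau(n) 2^{-\Omega(n)} \le 1$, with equality for squarefree $n$,
  the logarithmic sums of these weights have order $\sqrt{\ln N}$.\<close>
definition omega_weight :: "nat \<Rightarrow> real" where
  "omega_weight n = (1 / 2) ^ size (prime_factorization n)"

text \<open>Two weights because each has its own strength: \<open>omega_weight\<close> is completely
  multiplicative and supplies the upper bounds for logarithmic sums, while on squarefree n the
  logarithm is a sum over distinct primes, without prime powers.\<close>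

definition sqf_weight :: "nat \<Rightarrow> real" where
  "sqf_weight n = (if squarefree n then omega_weight n else 0)"

definition logsum :: "(nat \<Rightarrow> real) \<Rightarrow> nat \<Rightarrow> real" where
  "logsum f N = (\<Sum>n=1..N. f n / real n)"

lemma omega_weight_nonneg: "0 \<le> omega_weight n"
  by (simp add: omega_weight_def)

lemma omega_weight_le_1: "omega_weight n \<le> 1"
  by (simp add: omega_weight_def power_le_one)

lemma omega_weight_mult:
  "a > 0 \<Longrightarrow> b > 0 \<Longrightarrow> omega_weight (a * b) = omega_weight a * omega_weight b"
  by (simp add: omega_weight_def prime_factorization_mult power_add)

lemma omega_weight_prime: "prime p \<Longrightarrow> omega_weight p = 1 / 2"
  by (simp add: omega_weight_def prime_factorization_prime)

lemma sqf_weight_nonneg: "0 \<le> sqf_weight n"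
  by (simp add: sqf_weight_def omega_weight_nonneg)

lemma sqf_weight_le_omega_weight: "sqf_weight n \<le> omega_weight n"
  by (simp add: sqf_weight_def omega_weight_nonneg)

lemma sqf_weight_le_1: "sqf_weight n \<le> 1"
  using sqf_weight_le_omega_weight omega_weight_le_1 order.trans by blast

lemma sqf_weight_1 [simp]: "sqf_weight 1 = 1" "sqf_weight (Suc 0) = 1"
  by (simp_all add: sqf_weight_def omega_weight_def)

text \<open>Factors of a squarefree number are squarefree, and then equality holds. Otherwise the
  left side is 0, possibly against a positive right side, as for a = b = 2.\<close>

lemma sqf_weight_mult_le:
  "a > 0 \<Longrightarrow> b > 0 \<Longrightarrow> sqf_weight (a * b) \<le> sqf_weight a * sqf_weight b"
  by (auto simp: sqf_weight_def omega_weight_mult omega_weight_nonneg dest: squarefree_multD)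

section \<open>Number of divisors against the weight\<close>

lemma card_divisors_prime_mult_le:
  fixes n :: nat
  assumes "prime p" "n > 0"
  shows "card {d. d dvd p * n} \<le> 2 * card {d. d dvd n}"
proof -
  \<comment> \<open>A divisor of p * n is either prime to p, hence a divisor of n, or p times a
    divisor of n. The two families overlap if p dvd n, so only an inequality results.\<close>
  have "{d. d dvd p * n} \<subseteq> {d. d dvd n} \<union> (*) p ` {d. d dvd n}"
  proof
    fix d assume "d \<in> {d. d dvd p * n}"
    then have d: "d dvd p * n" by simp
    show "d \<in> {d. d dvd n} \<union> (*) p ` {d. d dvd n}"
    proof (cases "p dvd d")
      case True
      then obtain e where "d = p * e" by (elim dvdE)
      then show ?thesis using d assms by auto
    next
      case False
      then have "coprime d p" using assms prime_imp_coprime coprime_commute by blast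
      then show ?thesis using d by (simp add: coprime_dvd_mult_right_iff)
    qed
  qed
  then have "card {d. d dvd p * n} \<le> card ({d. d dvd n} \<union> (*) p ` {d. d dvd n})"
    using assms by (intro card_mono) auto
  also have "\<dots> \<le> card {d. d dvd n} + card ((*) p ` {d. d dvd n})" by (rule card_Un_le)
  also have "\<dots> \<le> card {d. d dvd n} + card {d. d dvd n}"
    using assms by (intro add_left_mono card_image_le) auto
  finally show ?thesis by simp
qed

lemma card_divisors_prime_mult_ge:
  fixes n :: nat
  assumes "prime p" "n > 0" "\<not> p dvd n"
  shows "card {d. d dvd p * n} \<ge> 2 * card {d. d dvd n}"
proof -
  have "inj_on ((*) p) {d. d dvd n}" using assms by (auto simp: inj_on_def)
  then have "2 * card {d. d dvd n} = card {d. d dvd n} + card ((*) p ` {d. d dvd n})"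
    by (simp add: card_image)
  also have "\<dots> = card ({d. d dvd n} \<union> (*) p ` {d. d dvd n})"
    by (rule card_Un_disjoint[symmetric]) (use assms in \<open>auto dest: dvd_mult_left\<close>)
  also have "\<dots> \<le> card {d. d dvd p * n}"
    using assms by (intro card_mono) (auto simp: prime_gt_0_nat)
  finally show ?thesis .
qed

text \<open>A further prime factor at most doubles the number of divisors and halves the
  weight.\<close>

lemma card_divisors_omega_weight_le:
  "n > 0 \<Longrightarrow> real (card {d. d dvd n}) * omega_weight n \<le> 1"
proof (induction n rule: prime_divisors_induct)
  case (factor p x)
  then have "p > 0" "x > 0" by (auto simp: prime_gt_0_nat)
  have "real (card {d. d dvd p * x}) * omega_weight (p * x)
      \<le> real (2 * card {d. d dvd x}) * omega_weight (p * x)"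
    by (intro mult_right_mono omega_weight_nonneg of_nat_mono card_divisors_prime_mult_le) fact+
  also have "\<dots> = real (card {d. d dvd x}) * omega_weight x"
    using factor \<open>p > 0\<close> \<open>x > 0\<close> by (simp add: omega_weight_mult omega_weight_prime)
  also have "\<dots> \<le> 1" using factor \<open>x > 0\<close> by simp
  finally show ?case .
qed (auto simp: omega_weight_def)

lemma card_divisors_omega_weight_ge:
  "squarefree n \<Longrightarrow> real (card {d. d dvd n}) * omega_weight n \<ge> 1"
proof (induction n rule: prime_divisors_induct)
  case (factor p x)
  have sq: "squarefree x" using factor.prems squarefree_multD by blast
  have "\<not> p dvd x"
  proof
    assume "p dvd x"
    then have "p\<^sup>2 dvd p * x" by (simp add: power2_eq_square)
    then have "p dvd 1" using factor.prems squarefreeD by blast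
    then show False using factor.hyps by simp
  qed
  have "x > 0" using sq by (intro Nat.gr0I) auto
  have "p > 0" using factor.hyps by (simp add: prime_gt_0_nat)
  have "1 \<le> real (card {d. d dvd x}) * omega_weight x" using factor sq by simp
  also have "\<dots> = real (2 * card {d. d dvd x}) * omega_weight (p * x)"
    using factor \<open>p > 0\<close> \<open>x > 0\<close> by (simp add: omega_weight_mult omega_weight_prime)
  also have "\<dots> \<le> real (card {d. d dvd p * x}) * omega_weight (p * x)"
    by (intro mult_right_mono omega_weight_nonneg of_nat_mono card_divisors_prime_mult_ge) fact+
  finally show ?case .
qed (auto simp: omega_weight_def)

section \<open>Logarithmic sums through convolution squares\<close>

lemma logsum_mono: "(\<And>n. n \<ge> 1 \<Longrightarrow> f n \<le> g n) \<Longrightarrow> logsum f N \<le> logsum g N"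
  unfolding logsum_def by (intro sum_mono divide_right_mono) auto

lemma logsum_nonneg: "(\<And>n. f n \<ge> 0) \<Longrightarrow> logsum f N \<ge> 0"
  unfolding logsum_def by (intro sum_nonneg divide_nonneg_nonneg) auto

lemma logsum_convolution:
  "logsum (\<lambda>n. \<Sum>d | d dvd n. u d * u (n div d)) N
    = (\<Sum>a=1..N. \<Sum>b=1..N div a. (u a / real a) * (u b / real b))"
proof -
  have "logsum (\<lambda>n. \<Sum>d | d dvd n. u d * u (n div d)) N
      = (\<Sum>n=1..N. \<Sum>d | d dvd n. (u d / real d) * (u (n div d) / real (n div d)))"
    unfolding logsum_def
  proof (intro sum.cong refl)
    fix n assume "n \<in> {1..N}"
    have "(\<Sum>d | d dvd n. u d * u (n div d)) / real n = (\<Sum>d | d dvd n. u d * u (n div d) / real n)"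
      by (rule sum_divide_distrib)
    also have "\<dots> = (\<Sum>d | d dvd n. (u d / real d) * (u (n div d) / real (n div d)))"
      by (intro sum.cong refl) (auto simp: real_of_nat_div)
    finally show "(\<Sum>d | d dvd n. u d * u (n div d)) / real n = \<dots>" .
  qed
  also have "\<dots> = (\<Sum>a=1..N. \<Sum>b=1..N div a. (u a / real a) * (u b / real b))"
    by (rule sum_divisors)
  finally show ?thesis .
qed

text \<open>The box a, b <= N lies under the hyperbola a b <= N^2. Raising the cutoff to N^2 merely
  doubles the logarithm.\<close>

lemma logsum_square_le:
  assumes "\<And>n. u n \<ge> 0"
    and "\<And>n. n \<ge> 1 \<Longrightarrow> (\<Sum>d | d dvd n. u d * u (n div d)) \<le> v n"
  shows "(logsum u N)\<^sup>2 \<le> logsum v (N\<^sup>2)"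
proof -
  have "(logsum u N)\<^sup>2 = (\<Sum>a=1..N. \<Sum>b=1..N. (u a / real a) * (u b / real b))"
    by (simp add: logsum_def power2_eq_square sum_product)
  also have "\<dots> \<le> (\<Sum>a=1..N. \<Sum>b=1..N\<^sup>2 div a. (u a / real a) * (u b / real b))"
  proof (intro sum_mono sum_mono2)
    fix a assume "a \<in> {1..N}"
    then have "N \<le> N\<^sup>2 div a" by (simp add: less_eq_div_iff_mult_less_eq power2_eq_square)
    then show "{1..N} \<subseteq> {1..N\<^sup>2 div a}" by auto
  qed (auto simp: assms)
  also have "\<dots> \<le> (\<Sum>a=1..N\<^sup>2. \<Sum>b=1..N\<^sup>2 div a. (u a / real a) * (u b / real b))"
  proof (rule sum_mono2)
    have "N \<le> N\<^sup>2" by (simp add: power2_eq_square)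
    then show "{1..N} \<subseteq> {1..N\<^sup>2}" by auto
  qed (auto intro!: sum_nonneg simp: assms)
  also have "\<dots> = logsum (\<lambda>n. \<Sum>d | d dvd n. u d * u (n div d)) (N\<^sup>2)"
    by (rule logsum_convolution[symmetric])
  also have "\<dots> \<le> logsum v (N\<^sup>2)" by (intro logsum_mono assms)
  finally show ?thesis .
qed

text \<open>Conversely, the region a b <= N lies inside the box a, b <= N, so the cutoff stays the
  same.\<close>

lemma logsum_square_ge:
  assumes "\<And>n. u n \<ge> 0"
    and "\<And>n. n \<ge> 1 \<Longrightarrow> v n \<le> (\<Sum>d | d dvd n. u d * u (n div d))"
  shows "logsum v N \<le> (logsum u N)\<^sup>2"
proof -
  have "logsum v N \<le> logsum (\<lambda>n. \<Sum>d | d dvd n. u d * u (n div d)) N"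
    by (intro logsum_mono assms)
  also have "\<dots> = (\<Sum>a=1..N. \<Sum>b=1..N div a. (u a / real a) * (u b / real b))"
    by (rule logsum_convolution)
  also have "\<dots> \<le> (\<Sum>a=1..N. \<Sum>b=1..N. (u a / real a) * (u b / real b))"
  proof (intro sum_mono sum_mono2)
    fix a assume "a \<in> {1..N}"
    have "N div a \<le> N" by simp
    then show "{1..N div a} \<subseteq> {1..N}" by auto
  qed (auto simp: assms)
  also have "\<dots> = (logsum u N)\<^sup>2"
    by (simp add: logsum_def power2_eq_square sum_product)
  finally show ?thesis .
qed

lemma omega_weight_divisor:
  assumes "n \<ge> 1" "d dvd n"
  shows "omega_weight d * omega_weight (n div d) = omega_weight n"
proof -
  obtain e where "n = d * e" using assms by (elim dvdE)
  then show ?thesis using assms by (auto simp: omega_weight_mult)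
qed

lemma logsum_1_le: "N \<ge> 1 \<Longrightarrow> logsum (\<lambda>_. 1) N \<le> 1 + ln (real N)"
proof (induction N rule: nat_induct_at_least)
  case base
  then show ?case by (simp add: logsum_def)
next
  case (Suc n)
  have "ln (real n / real (Suc n)) \<le> real n / real (Suc n) - 1"
    by (rule ln_le_minus_one) (use Suc in auto)
  then have "1 / real (Suc n) \<le> ln (real (Suc n)) - ln (real n)"
    using Suc by (simp add: ln_div field_simps)
  then show ?case using Suc by (simp add: logsum_def)
qed

lemma logsum_1_ge: "N \<ge> 1 \<Longrightarrow> ln (real N) \<le> logsum (\<lambda>_. 1) N"
proof -
  assume "N \<ge> 1"
  then have "ln (real N) \<le> ln (real N + 1)" by simp
  also have "\<dots> \<le> logsum (\<lambda>_. 1) N"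
    using ln_le_harm[of N] by (simp add: logsum_def harm_def divide_inverse)
  finally show ?thesis .
qed

lemma logsum_omega_weight_le:
  assumes "N \<ge> 1"
  shows "(logsum omega_weight N)\<^sup>2 \<le> 1 + 2 * ln (real N)"
proof -
  have "(logsum omega_weight N)\<^sup>2 \<le> logsum (\<lambda>_. 1) (N\<^sup>2)"
  proof (rule logsum_square_le)
    fix n :: nat assume n: "n \<ge> 1"
    have "(\<Sum>d | d dvd n. omega_weight d * omega_weight (n div d)) = (\<Sum>d | d dvd n. omega_weight n)"
      by (intro sum.cong refl) (use n in \<open>simp add: omega_weight_divisor\<close>)
    then show "(\<Sum>d | d dvd n. omega_weight d * omega_weight (n div d)) \<le> 1"
      using card_divisors_omega_weight_le[of n] n by simp
  qed (rule omega_weight_nonneg)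
  also have "\<dots> \<le> 1 + ln (real (N\<^sup>2))" by (rule logsum_1_le) (use assms in simp)
  finally show ?thesis using assms by (simp add: ln_realpow)
qed

text \<open>The convolution square of 4^-Omega is tau(n) 4^-Omega(n), at most 2^-Omega(n), whose
  convolution square is in turn at most 1. Squaring the sum twice thus leads to the harmonic sum up
  to N^4: hence the exponent 1/4 and the term 4 ln N.\<close>

lemma logsum_sqf_weight_square_le:
  assumes "N \<ge> 1"
  shows "logsum (\<lambda>n. (sqf_weight n)\<^sup>2) N \<le> (1 + 4 * ln (real N)) powr (1 / 4)"
proof -
  let ?H = "logsum (\<lambda>n. (omega_weight n)\<^sup>2) N"
  have "?H\<^sup>2 \<le> logsum omega_weight (N\<^sup>2)"
  proof (rule logsum_square_le)
    fix n :: nat assume n: "n \<ge> 1"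
    have "(\<Sum>d | d dvd n. (omega_weight d)\<^sup>2 * (omega_weight (n div d))\<^sup>2) = (\<Sum>d | d dvd n. (omega_weight n)\<^sup>2)"
      by (intro sum.cong refl) (use n in \<open>simp add: omega_weight_divisor power_mult_distrib[symmetric]\<close>)
    also have "\<dots> = (real (card {d. d dvd n}) * omega_weight n) * omega_weight n"
      by (simp add: power2_eq_square)
    also have "\<dots> \<le> 1 * omega_weight n"
      by (intro mult_right_mono card_divisors_omega_weight_le omega_weight_nonneg) (use n in simp)
    finally show "(\<Sum>d | d dvd n. (omega_weight d)\<^sup>2 * (omega_weight (n div d))\<^sup>2) \<le> omega_weight n" by simp
  qed simp
  then have "(?H\<^sup>2)\<^sup>2 \<le> (logsum omega_weight (N\<^sup>2))\<^sup>2" by (intro power_mono) auto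
  also have "\<dots> \<le> 1 + 2 * ln (real (N\<^sup>2))" by (rule logsum_omega_weight_le) (use assms in simp)
  also have "\<dots> = 1 + 4 * ln (real N)" using assms by (simp add: ln_realpow)
  finally have "?H ^ 4 \<le> 1 + 4 * ln (real N)" by simp
  moreover have "?H \<ge> 0" by (rule logsum_nonneg) simp
  ultimately have "?H \<le> root 4 (1 + 4 * ln (real N))"
    using real_root_le_mono[of 4 "?H ^ 4"] by (simp add: real_root_power_cancel)
  also have "\<dots> = (1 + 4 * ln (real N)) powr (1 / 4)"
    using assms by (subst root_powr_inverse) (auto intro: add_pos_nonneg)
  finally have "?H \<le> (1 + 4 * ln (real N)) powr (1 / 4)" .
  moreover have "logsum (\<lambda>n. (sqf_weight n)\<^sup>2) N \<le> ?H"
    by (intro logsum_mono power_mono sqf_weight_le_omega_weight sqf_weight_nonneg)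
  ultimately show ?thesis by linarith
qed

lemma sum_inverse_squares_le: "(\<Sum>k=1..N. 1 / (real k)\<^sup>2) \<le> 2"
proof -
  have "(\<Sum>k=1..N. 1 / (real k)\<^sup>2) \<le> 2 - 1 / real N" if "N \<ge> 1"
    using that
  proof (induction N rule: nat_induct_at_least)
    case (Suc n)
    have "1 / (real (Suc n))\<^sup>2 \<le> 1 / (real n * real (Suc n))"
      using Suc by (intro divide_left_mono) (auto simp: power2_eq_square)
    also have "\<dots> = 1 / real n - 1 / real (Suc n)" using Suc by (simp add: field_simps)
    finally show ?case using Suc by simp
  qed simp
  then show ?thesis by (cases "N \<ge> 1") (auto intro: order.trans)
qed

text \<open>Each n is s k^2 with s squarefree, and (s, k) determines n. So the harmonic sum is at
  most the squarefree one times the sum of 1 / k^2, which is at most 2.\<close>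

lemma logsum_squarefree_ge:
  "logsum (\<lambda>_. 1) N \<le> 2 * logsum (\<lambda>n. if squarefree n then 1 else 0) N"
proof -
  let ?S = "{n\<in>{1..N}. squarefree n}"
  let ?f = "\<lambda>n::nat. (squarefree_part n, square_part n)"
  have dec: "n = squarefree_part n * (square_part n)\<^sup>2" for n :: nat
    by (rule squarefree_decompose)
  have "inj_on ?f {1..N}" by (rule inj_onI) (metis dec prod.inject)
  have sub: "?f ` {1..N} \<subseteq> ?S \<times> {1..N}"
  proof
    fix x assume "x \<in> ?f ` {1..N}"
    then obtain n where n: "x = ?f n" "1 \<le> n" "n \<le> N" by auto
    have "squarefree_part n dvd n" "square_part n dvd n" 
      by (metis dec dvd_triv_left) (metis dec dvd_mult dvd_triv_left power2_eq_square)
    then have "squarefree_part n \<le> n" "square_part n \<le> n" using n by (auto intro!: dvd_imp_le)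
    moreover have "squarefree_part n > 0" "square_part n > 0" using n by (auto intro!: Nat.gr0I)
    ultimately show "x \<in> ?S \<times> {1..N}" using n by auto
  qed
  have "logsum (\<lambda>_. 1) N = (\<Sum>n=1..N. (\<lambda>(s, k). (1 / real s) * (1 / (real k)\<^sup>2)) (?f n))"
    unfolding logsum_def
    by (intro sum.cong refl) (subst dec, simp)
  also have "\<dots> = (\<Sum>(s, k)\<in>?f ` {1..N}. (1 / real s) * (1 / (real k)\<^sup>2))"
    by (subst sum.reindex[OF \<open>inj_on ?f {1..N}\<close>]) simp
  also have "\<dots> \<le> (\<Sum>(s, k)\<in>?S \<times> {1..N}. (1 / real s) * (1 / (real k)\<^sup>2))"
    by (rule sum_mono2[OF _ sub]) auto
  also have "\<dots> = (\<Sum>s\<in>?S. 1 / real s) * (\<Sum>k=1..N. 1 / (real k)\<^sup>2)"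
    by (simp add: sum_product sum.cartesian_product)
  also have "\<dots> \<le> (\<Sum>s\<in>?S. 1 / real s) * 2"
    by (intro mult_left_mono sum_inverse_squares_le sum_nonneg) auto
  also have "(\<Sum>s\<in>?S. 1 / real s) = logsum (\<lambda>n. if squarefree n then 1 else 0) N"
    unfolding logsum_def by (intro sum.mono_neutral_cong_left) auto
  finally show ?thesis by simp
qed

text \<open>Divisors of a squarefree n are squarefree, so the convolution square at n is tau(n)
  2^-Omega(n) >= 1, and the squarefree harmonic sum bounds the square from below. This is what keeps
  the mean of the random variable away from 0.\<close>

lemma logsum_sqf_weight_ge:
  assumes "N \<ge> 1"
  shows "ln (real N) / 2 \<le> (logsum sqf_weight N)\<^sup>2"
proof -
  have "logsum (\<lambda>n. if squarefree n then 1 else 0) N \<le> (logsum sqf_weight N)\<^sup>2"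
  proof (rule logsum_square_ge)
    fix n :: nat assume n: "n \<ge> 1"
    show "(if squarefree n then 1 else 0) \<le> (\<Sum>d | d dvd n. sqf_weight d * sqf_weight (n div d))"
    proof (cases "squarefree n")
      case True
      have "sqf_weight d * sqf_weight (n div d) = omega_weight n" if "d dvd n" for d
      proof -
        have "n div d dvd n" using that by auto
        then have "squarefree d" "squarefree (n div d)" using that True squarefree_mono by blast+
        then show ?thesis using that n by (simp add: sqf_weight_def omega_weight_divisor)
      qed
      then have "(\<Sum>d | d dvd n. sqf_weight d * sqf_weight (n div d)) = (\<Sum>d | d dvd n. omega_weight n)"
        by (intro sum.cong) auto
      then show ?thesis using card_divisors_omega_weight_ge[OF True] by simp
    next
      case False
      then show ?thesis by (auto intro!: sum_nonneg simp: sqf_weight_nonneg)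
    qed
  qed (rule sqf_weight_nonneg)
  then show ?thesis using logsum_squarefree_ge[of N] logsum_1_ge[OF assms] by linarith
qed

section \<open>Mean values of the weight\<close>

lemma ln_squarefree:
  fixes n :: nat
  assumes "squarefree n"
  shows "ln (real n) = (\<Sum>d | d dvd n. if prime d then ln (real d) else 0)"
proof -
  have n: "n > 0" using assms by (intro Nat.gr0I) auto
  have mult: "multiplicity p n = 1" if "p \<in> prime_factors n" for p
  proof -
    have "multiplicity p n \<le> 1"
      using assms n that by (auto simp: squarefree_factorial_semiring'')
    moreover have "multiplicity p n > 0" using that n
      by (simp add: prime_factors_multiplicity)
    ultimately show ?thesis by simp
  qed
  have "n = (\<Prod>p\<in>prime_factors n. p ^ multiplicity p n)"
    using n by (simp add: prime_factorization_nat)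
  also have "\<dots> = \<Prod>(prime_factors n)" by (intro prod.cong) (auto simp: mult)
  finally have "ln (real n) = ln (real (\<Prod>(prime_factors n)))" by simp
  also have "\<dots> = (\<Sum>p\<in>prime_factors n. ln (real p))"
    by (subst of_nat_prod, subst ln_prod) (auto dest: in_prime_factors_imp_prime prime_gt_0_nat)
  \<comment> \<open>The range is enlarged to all divisors to match
    \<open>sum_divisors\<close>.\<close>
  also have "\<dots> = (\<Sum>d | d dvd n. if prime d then ln (real d) else 0)"
    using n by (intro sum.mono_neutral_cong_left) (auto simp: in_prime_factors_iff)
  finally show ?thesis .
qed

definition weight_sum :: "nat \<Rightarrow> real" where
  "weight_sum N = (\<Sum>n=1..N. sqf_weight n)"

lemma weight_sum_nonneg: "0 \<le> weight_sum N"
  unfolding weight_sum_def by (intro sum_nonneg sqf_weight_nonneg)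

text \<open>Weighting with $\ln N = \ln n + \ln (N / n)$ and splitting off one prime factor from
  $\ln n$ saves the factor $\ln N$ over the trivial bound.\<close>
lemma weight_sum_ln_le:
  assumes "N \<ge> 1"
  shows "weight_sum N * ln (real N) \<le> (1 + ln 4) * real N * logsum sqf_weight N"
proof -
  let ?t = "\<lambda>a. if prime a then ln (real a) else 0"
  have t_nonneg: "?t a \<ge> 0" for a by (auto dest: prime_gt_0_nat)
  have "(\<Sum>n=1..N. sqf_weight n * ln (real n))
      \<le> (\<Sum>n=1..N. \<Sum>d | d dvd n. sqf_weight (n div d) * ?t d)"
  proof (rule sum_mono)
    fix n assume n: "n \<in> {1..N}"
    show "sqf_weight n * ln (real n) \<le> (\<Sum>d | d dvd n. sqf_weight (n div d) * ?t d)"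
    proof (cases "squarefree n")
      case True
      have "sqf_weight n * ln (real n) = (\<Sum>d | d dvd n. sqf_weight n * ?t d)"
        by (subst ln_squarefree[OF True]) (rule sum_distrib_left)
      also have "\<dots> \<le> (\<Sum>d | d dvd n. sqf_weight (n div d) * ?t d)"
      proof (intro sum_mono mult_right_mono t_nonneg)
        fix d assume "d \<in> {d. d dvd n}"
        then obtain e where e: "n = d * e" by auto
        then have "d > 0" "e > 0" using n by auto
        then have "sqf_weight n \<le> sqf_weight d * sqf_weight e" unfolding e by (rule sqf_weight_mult_le)
        \<comment> \<open>For prime d this gives away only a factor 2; for other d the term is
          multiplied by 0.\<close>
        also have "\<dots> \<le> sqf_weight e"
          by (intro mult_left_le_one_le sqf_weight_nonneg sqf_weight_le_1)
        finally show "sqf_weight n \<le> sqf_weight (n div d)" using e \<open>d > 0\<close> by simp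
      qed
      finally show ?thesis .
    next
      case False
      have "0 \<le> (\<Sum>d | d dvd n. sqf_weight (n div d) * ?t d)"
        by (intro sum_nonneg mult_nonneg_nonneg sqf_weight_nonneg t_nonneg)
      then show ?thesis using False by (simp add: sqf_weight_def)
    qed
  qed
  also have "\<dots> = (\<Sum>a=1..N. \<Sum>b=1..N div a. sqf_weight b * ?t a)"
    by (rule sum_divisors[of "\<lambda>a b. sqf_weight b * ?t a"])
  \<comment> \<open>With the cofactor b fixed, the inner sum runs over the primes up to N div b,
    where Chebyshev's bound applies.\<close>
  also have "\<dots> = (\<Sum>b=1..N. \<Sum>a=1..N div b. sqf_weight b * ?t a)"
  proof -
    have S: "(SIGMA a:{1..N}. {1..N div a}) = {(a, b). 1 \<le> a \<and> 1 \<le> b \<and> a * b \<le> N}"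
    proof (intro set_eqI, clarify)
      fix a b :: nat
      have "a \<le> N" if "1 \<le> b" "a * b \<le> N"
        using order.trans[OF mult_le_mono2[OF that(1), of a] that(2)] by simp
      moreover have "b \<le> N div a \<longleftrightarrow> a * b \<le> N" if "1 \<le> a"
        using that less_eq_div_iff_mult_less_eq[of a b N] by (simp add: mult.commute[of b])
      ultimately show "(a, b) \<in> (SIGMA a:{1..N}. {1..N div a})
          \<longleftrightarrow> (a, b) \<in> {(a, b). 1 \<le> a \<and> 1 \<le> b \<and> a * b \<le> N}"
        unfolding mem_Sigma_iff atLeastAtMost_iff mem_Collect_eq prod.case by blast
    qed
    have "(\<Sum>a=1..N. \<Sum>b=1..N div a. sqf_weight b * ?t a)
        = (\<Sum>(a, b)\<in>{(a, b). 1 \<le> a \<and> 1 \<le> b \<and> a * b \<le> N}. sqf_weight b * ?t a)"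
      by (subst sum.Sigma) (simp_all add: S[unfolded One_nat_def])
    also have "\<dots> = (\<Sum>(b, a)\<in>{(a, b). 1 \<le> a \<and> 1 \<le> b \<and> a * b \<le> N}. sqf_weight b * ?t a)"
      by (rule sum.reindex_bij_witness[of _ prod.swap prod.swap]) (auto simp: mult.commute)
    also have "\<dots> = (\<Sum>b=1..N. \<Sum>a=1..N div b. sqf_weight b * ?t a)"
      by (subst sum.Sigma) (simp_all add: S[unfolded One_nat_def])
    finally show ?thesis .
  qed
  also have "\<dots> = (\<Sum>b=1..N. sqf_weight b * (\<Sum>a=1..N div b. ?t a))"
    by (simp add: sum_distrib_left)
  also have "\<dots> \<le> (\<Sum>b=1..N. sqf_weight b * (real N / real b * ln 4))"
  proof (intro sum_mono mult_left_mono sqf_weight_nonneg)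
    fix b assume "b \<in> {1..N}"
    have "(\<Sum>a=1..N div b. ?t a) \<le> real (N div b) * ln 4" by (rule chebyshev_theta_le)
    also have "\<dots> \<le> real N / real b * ln 4"
      by (intro mult_right_mono) (auto intro: of_nat_div_le_of_nat)
    finally show "(\<Sum>a=1..N div b. ?t a) \<le> real N / real b * ln 4" .
  qed
  also have "\<dots> = ln 4 * real N * logsum sqf_weight N"
    by (simp add: logsum_def sum_distrib_left mult_ac)
  finally have 1: "(\<Sum>n=1..N. sqf_weight n * ln (real n)) \<le> ln 4 * real N * logsum sqf_weight N" .
  \<comment> \<open>The crude ln t <= t already gives the right order for this half; it contributes
    the 1 in 1 + ln 4.\<close>
  have "(\<Sum>n=1..N. sqf_weight n * ln (real N / real n)) \<le> (\<Sum>n=1..N. sqf_weight n * (real N / real n))"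
  proof (intro sum_mono mult_left_mono sqf_weight_nonneg)
    fix n assume "n \<in> {1..N}"
    then show "ln (real N / real n) \<le> real N / real n"
      using ln_le_minus_one[of "real N / real n"] by simp
  qed
  also have "\<dots> = real N * logsum sqf_weight N"
    by (simp add: logsum_def sum_distrib_left mult_ac)
  finally have 2: "(\<Sum>n=1..N. sqf_weight n * ln (real N / real n)) \<le> real N * logsum sqf_weight N" .
  have "weight_sum N * ln (real N)
      = (\<Sum>n=1..N. sqf_weight n * ln (real n)) + (\<Sum>n=1..N. sqf_weight n * ln (real N / real n))"
    unfolding weight_sum_def sum_distrib_right sum.distrib[symmetric]
    by (intro sum.cong) (auto simp: ln_div algebra_simps)
  then show ?thesis using 1 2 by (simp add: algebra_simps)
qed

lemma logsum_sqf_weight_Suc: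
  "logsum sqf_weight (Suc N) = logsum sqf_weight N + sqf_weight (Suc N) / real (Suc N)"
  by (simp add: logsum_def)

lemma logsum_sqf_weight_ge_1: "N \<ge> 1 \<Longrightarrow> 1 \<le> logsum sqf_weight N"
  by (induction N rule: nat_induct_at_least)
     (auto simp: logsum_def sqf_weight_nonneg intro: add_increasing2)

lemma logsum_sqf_weight_square_upper:
  assumes "N \<ge> 1"
  shows "(logsum sqf_weight N)\<^sup>2 \<le> 1 + 2 * ln (real N)"
proof -
  have "(logsum sqf_weight N)\<^sup>2 \<le> (logsum omega_weight N)\<^sup>2"
    by (intro power_mono logsum_mono logsum_nonneg sqf_weight_le_omega_weight sqf_weight_nonneg)
  then show ?thesis using logsum_omega_weight_le[OF assms] by linarith
qed

text \<open>From \<open>weight_sum_ln_le\<close> with 1 + ln 4 <= 4, together with G^2 <= 1 + 2 ln N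
  <= 4 ln N, which trades G / ln N for 4 / G; so 16 = 4 * 4. The assumption N >= 2 keeps ln N >=
  1/2. Stating the bound through G and not through ln N is what makes the next sum
  telescope.\<close>

lemma weight_sum_le:
  assumes "N \<ge> 2"
  shows "weight_sum N / real N \<le> 16 / logsum sqf_weight N"
proof -
  let ?G = "logsum sqf_weight N"
  have G: "?G \<ge> 1" using assms by (intro logsum_sqf_weight_ge_1) simp
  have ln2: "ln (real N) \<ge> 1 / 2"
  proof -
    have "ln 2 \<le> ln (real N)" using assms by simp
    then show ?thesis using ln2_ge_two_thirds by linarith
  qed
  have "ln (4::real) = 2 * ln 2" using ln_realpow[of 2 2] by simp
  then have ln4: "ln (4::real) \<le> 2" using ln_le_minus_one[of "2::real"] by simp
  have "weight_sum N * ln (real N) \<le> (1 + ln 4) * real N * ?G"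
    by (rule weight_sum_ln_le) (use assms in simp)
  also have "\<dots> \<le> 4 * real N * ?G"
    using ln4 G by (intro mult_right_mono) auto
  finally have 1: "weight_sum N * ln (real N) * ?G \<le> 4 * real N * ?G * ?G"
    using G by (intro mult_right_mono) auto
  have "?G\<^sup>2 \<le> 1 + 2 * ln (real N)" by (rule logsum_sqf_weight_square_upper) (use assms in simp)
  also have "\<dots> \<le> 4 * ln (real N)" using ln2 by simp
  finally have "4 * real N * ?G\<^sup>2 \<le> 4 * real N * (4 * ln (real N))"
    by (intro mult_left_mono) auto
  then have "weight_sum N * ?G * ln (real N) \<le> 16 * real N * ln (real N)"
    using 1 by (simp add: power2_eq_square mult_ac)
  then have "weight_sum N * ?G \<le> 16 * real N" using ln2 by simp
  then show ?thesis using G assms by (simp add: field_simps)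
qed

text \<open>With $G$ the logarithmic sum of the weights, the previous bound makes the summand at most
  $16 (G(n) - G(n-1)) / G(n)$, and these telescope in $\ln G$.\<close>
lemma logsum_weight_sum_le:
  assumes "N \<ge> 1"
  shows "logsum (\<lambda>n. sqf_weight n * (weight_sum n / real n)) N \<le> 1 + 16 * ln (logsum sqf_weight N)"
  using assms
proof (induction N rule: nat_induct_at_least)
  \<comment> \<open>The summand at 1 equals 1 and lies outside the range of
    \<open>weight_sum_le\<close>; it is the 1 in the bound.\<close>
  case base
  then show ?case by (simp add: logsum_def weight_sum_def)
next
  case (Suc n)
  let ?G = "logsum sqf_weight" and ?x = "sqf_weight (Suc n) / real (Suc n)"
  have G: "?G n \<ge> 1" "?G (Suc n) \<ge> 1" using Suc by (auto intro!: logsum_sqf_weight_ge_1)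
  have x: "?x \<ge> 0" by (simp add: sqf_weight_nonneg)
  have "?x * (weight_sum (Suc n) / real (Suc n)) \<le> ?x * (16 / ?G (Suc n))"
    by (rule mult_left_mono[OF weight_sum_le x]) (use Suc in simp)
  also have "\<dots> = 16 * (1 - ?G n / ?G (Suc n))"
  proof -
    have x_eq: "?x = ?G (Suc n) - ?G n" by (simp add: logsum_sqf_weight_Suc)
    show ?thesis unfolding x_eq using G by (simp add: field_simps)
  qed
  also have "\<dots> \<le> 16 * (ln (?G (Suc n)) - ln (?G n))"
    using ln_le_minus_one[of "?G n / ?G (Suc n)"] G by (simp add: ln_div)
  finally have "?x * (weight_sum (Suc n) / real (Suc n)) \<le> 16 * (ln (?G (Suc n)) - ln (?G n))" .
  then show ?case using Suc by (simp add: logsum_def)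
qed

text \<open>Bound gcd(q, r) by the sum of the common divisors d and write q = d e, r = d s with s <=
  e. Submultiplicativity extracts w(d)^2 w(e) w(s), the sum over s is \<open>weight_sum e\<close>,
  and d / q^2 = 1 / (d e^2). Enlarging d e <= N to a box separates d from e.\<close>

lemma gcd_sum_le:
  assumes "N \<ge> 1"
  shows "(\<Sum>q=1..N. \<Sum>r=1..q. sqf_weight q * sqf_weight r * real (gcd q r) / (real q)\<^sup>2)
    \<le> logsum (\<lambda>n. (sqf_weight n)\<^sup>2) N * logsum (\<lambda>n. sqf_weight n * (weight_sum n / real n)) N"
proof -
  define g where "g d e = ((sqf_weight d)\<^sup>2 / real d) * (sqf_weight e * (weight_sum e / real e) / real e)" for d e
  have g_nonneg: "g d e \<ge> 0" for d e
    by (simp add: g_def sqf_weight_nonneg weight_sum_nonneg)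
  have "(\<Sum>r=1..q. sqf_weight q * sqf_weight r * real (gcd q r) / (real q)\<^sup>2)
      \<le> (\<Sum>d | d dvd q. g d (q div d))" if "q \<in> {1..N}" for q
  proof -
    have q: "q > 0" using that by simp
    \<comment> \<open>The exact identity has the totient of d as coefficient; with d itself, the
      single term d = gcd(q, r) suffices.\<close>
    have gcd_le: "real (gcd q r) \<le> (\<Sum>d | d dvd q. if d dvd r then real d else 0)" for r
    proof -
      have "real (gcd q r) = (\<Sum>d\<in>{gcd q r}. if d dvd r then real d else 0)" by simp
      also have "\<dots> \<le> (\<Sum>d | d dvd q. if d dvd r then real d else 0)"
        using q by (intro sum_mono2) auto
      finally show ?thesis .
    qed
    have "(\<Sum>r=1..q. sqf_weight q * sqf_weight r * real (gcd q r) / (real q)\<^sup>2)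
        \<le> (\<Sum>r=1..q. sqf_weight q * sqf_weight r * (\<Sum>d | d dvd q. if d dvd r then real d else 0) / (real q)\<^sup>2)"
      by (intro sum_mono divide_right_mono mult_left_mono gcd_le) (auto simp: sqf_weight_nonneg)
    also have "\<dots> = (\<Sum>r=1..q. \<Sum>d | d dvd q. sqf_weight q * real d / (real q)\<^sup>2 * (if d dvd r then sqf_weight r else 0))"
      unfolding sum_distrib_left sum_divide_distrib by (intro sum.cong refl) auto
    also have "\<dots> = (\<Sum>d | d dvd q. sqf_weight q * real d / (real q)\<^sup>2 * (\<Sum>r=1..q. if d dvd r then sqf_weight r else 0))"
      by (subst sum.swap) (simp add: sum_distrib_left)
    also have "\<dots> \<le> (\<Sum>d | d dvd q. g d (q div d))"
    proof (rule sum_mono)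
      fix d assume "d \<in> {d. d dvd q}"
      then obtain e where e: "q = d * e" by auto
      then have de: "d > 0" "e > 0" using q by auto
      have "(\<Sum>r=1..q. if d dvd r then sqf_weight r else 0) = (\<Sum>r\<in>{r\<in>{1..q}. d dvd r}. sqf_weight r)"
        by (intro sum.inter_filter[symmetric]) simp
      also have "\<dots> = (\<Sum>s=1..e. sqf_weight (d * s))"
        by (rule sum.reindex_bij_witness[of _ "\<lambda>s. d * s" "\<lambda>r. r div d"])
           (use de e in \<open>auto simp: Suc_le_eq div_greater_zero_iff dvd_imp_le elim!: dvdE\<close>)
      also have "\<dots> \<le> (\<Sum>s=1..e. sqf_weight d * sqf_weight s)"
        using de by (intro sum_mono sqf_weight_mult_le) auto
      also have "\<dots> = sqf_weight d * weight_sum e" by (simp add: weight_sum_def sum_distrib_left)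
      finally have inner: "(\<Sum>r=1..q. if d dvd r then sqf_weight r else 0) \<le> sqf_weight d * weight_sum e" .
      have "sqf_weight q * real d / (real q)\<^sup>2 * (\<Sum>r=1..q. if d dvd r then sqf_weight r else 0)
          \<le> (sqf_weight d * sqf_weight e) * real d / (real q)\<^sup>2 * (sqf_weight d * weight_sum e)"
        by (intro mult_mono inner divide_right_mono mult_right_mono)
           (use de e in \<open>auto simp: sqf_weight_nonneg weight_sum_nonneg sqf_weight_mult_le intro!: sum_nonneg\<close>)
      also have "\<dots> = g d (q div d)"
        using de e by (simp add: g_def field_simps power2_eq_square)
      finally show "sqf_weight q * real d / (real q)\<^sup>2 * (\<Sum>r=1..q. if d dvd r then sqf_weight r else 0) \<le> g d (q div d)" .
    qed
    finally show ?thesis .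
  qed
  then have "(\<Sum>q=1..N. \<Sum>r=1..q. sqf_weight q * sqf_weight r * real (gcd q r) / (real q)\<^sup>2)
      \<le> (\<Sum>q=1..N. \<Sum>d | d dvd q. g d (q div d))" by (rule sum_mono)
  also have "\<dots> = (\<Sum>d=1..N. \<Sum>e=1..N div d. g d e)" by (rule sum_divisors)
  also have "\<dots> \<le> (\<Sum>d=1..N. \<Sum>e=1..N. g d e)"
  proof (intro sum_mono sum_mono2)
    fix d assume "d \<in> {1..N}"
    have "N div d \<le> N" by simp
    then show "{1..N div d} \<subseteq> {1..N}" by auto
  qed (auto simp: g_nonneg)
  also have "\<dots> = logsum (\<lambda>n. (sqf_weight n)\<^sup>2) N * logsum (\<lambda>n. sqf_weight n * (weight_sum n / real n)) N"
    by (simp add: g_def logsum_def sum_product)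
  finally show ?thesis .
qed

subsection \<open>Measures of approximation sets\<close>

lemma dist_int_less_iff: "dist_int x < \<delta> \<longleftrightarrow> (\<exists>n::int. \<bar>x - of_int n\<bar> < \<delta>)"
proof -
  have "dist_int x = (INF a\<in>\<int>. dist x a)" unfolding dist_int_def by (rule infdist_notempty) auto
  also have "\<dots> < \<delta> \<longleftrightarrow> (\<exists>a\<in>\<int>. dist x a < \<delta>)"
    by (rule cINF_less_iff) (auto intro!: bdd_belowI[of _ 0])
  also have "\<dots> \<longleftrightarrow> (\<exists>n::int. \<bar>x - of_int n\<bar> < \<delta>)"
    by (auto simp: Ints_def dist_real_def)
  finally show ?thesis .
qed

lemma dist_int_less_add_int: "dist_int (x + of_int k) < \<delta> \<longleftrightarrow> dist_int x < \<delta>"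
proof -
  have "(\<exists>n::int. \<bar>x + of_int k - of_int n\<bar> < \<delta>) \<longleftrightarrow> (\<exists>n::int. \<bar>x - of_int n\<bar> < \<delta>)"
  proof
    assume "\<exists>n::int. \<bar>x + of_int k - of_int n\<bar> < \<delta>"
    then obtain n :: int where "\<bar>x + of_int k - of_int n\<bar> < \<delta>" by blast
    then have "\<bar>x - of_int (n - k)\<bar> < \<delta>" by (simp add: algebra_simps)
    then show "\<exists>n::int. \<bar>x - of_int n\<bar> < \<delta>" by blast
  next
    assume "\<exists>n::int. \<bar>x - of_int n\<bar> < \<delta>"
    then obtain n :: int where "\<bar>x - of_int n\<bar> < \<delta>" by blast
    then have "\<bar>x + of_int k - of_int (n + k)\<bar> < \<delta>" by (simp add: algebra_simps)
    then show "\<exists>n::int. \<bar>x + of_int k - of_int n\<bar> < \<delta>" by blast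
  qed
  then show ?thesis by (simp add: dist_int_less_iff)
qed

lemma borel_measurable_dist_int [measurable]: "dist_int \<in> borel_measurable borel"
  unfolding dist_int_def[abs_def]
  by (intro borel_measurable_continuous_onI continuous_on_infdist continuous_on_id)

lemma card_int_open_interval:
  fixes a l :: real
  assumes "l \<ge> 0"
  shows "finite {k::int. a < of_int k \<and> of_int k < a + l}"
    and "real (card {k::int. a < of_int k \<and> of_int k < a + l}) \<le> l + 1"
proof -
  have sub: "{k::int. a < of_int k \<and> of_int k < a + l} \<subseteq> {\<lfloor>a\<rfloor> + 1..\<lceil>a + l\<rceil> - 1}"
    by (auto; linarith)
  then show "finite {k::int. a < of_int k \<and> of_int k < a + l}" by (rule finite_subset) simp
  have "card {k::int. a < of_int k \<and> of_int k < a + l} \<le> card {\<lfloor>a\<rfloor> + 1..\<lceil>a + l\<rceil> - 1}"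
    by (rule card_mono[OF _ sub]) simp
  also have "\<dots> = nat (\<lceil>a + l\<rceil> - 1 - \<lfloor>a\<rfloor>)" by simp
  finally have "real (card {k::int. a < of_int k \<and> of_int k < a + l}) \<le> real (nat (\<lceil>a + l\<rceil> - 1 - \<lfloor>a\<rfloor>))"
    by (rule of_nat_mono)
  also have "\<dots> \<le> l + 1" using assms by linarith
  finally show "real (card {k::int. a < of_int k \<and> of_int k < a + l}) \<le> l + 1" .
qed

text \<open>In lowest terms r / q = r' / q', so modulo 1 the orbit runs d = gcd(q, r) times through
  q' equally spaced points. At most 2 \<delta> q' + 1 of these are close to an integer, and the
  rounding error 1, multiplied by d, is the origin of the gcd term.\<close>

lemma card_dist_int_orbit_le:
  assumes "q \<ge> 1" "\<delta> \<ge> 0"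
  shows "real (card {j\<in>{..<q}. dist_int (x + real (r * j) / real q) < \<delta>}) \<le> 2 * \<delta> * real q + real (gcd q r)"
proof -
  let ?d = "gcd q r"
  obtain q' r' where qr: "q = ?d * q'" "r = ?d * r'" "coprime q' r'"
    using gcd_coprime_exists[of q r] assms by (auto simp: mult.commute)
  have d: "?d > 0" and q': "q' > 0" using assms qr(1) by (auto intro!: Nat.gr0I)
  \<comment> \<open>Multiplying the condition by q' turns it into |q' x + k| < \<delta> q' for the
    integer k = r' j - n q'.\<close>
  define K where "K = {k::int. (- real q' * x - \<delta> * real q') < of_int k
    \<and> of_int k < (- real q' * x - \<delta> * real q') + 2 * \<delta> * real q'}"
  have finK: "finite K" and cardK: "real (card K) \<le> 2 * \<delta> * real q' + 1"
    unfolding K_def using assms by (intro card_int_open_interval; simp)+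
  \<comment> \<open>As r' is invertible modulo q', each block of q' consecutive indices contains at
    most one j of \<open>C k\<close>, and {..<q} consists of d such blocks.\<close>
  define C where "C k = {j\<in>{..<q}. [int (r' * j) = k] (mod int q')}" for k
  have card_C: "card (C k) \<le> ?d" for k
  proof -
    have "inj_on (\<lambda>j. j div q') (C k)"
    proof (rule inj_onI)
      fix i j assume ij: "i \<in> C k" "j \<in> C k" "i div q' = j div q'"
      have "[int (r' * i) = int (r' * j)] (mod int q')"
        using ij by (auto simp: C_def intro: cong_trans cong_sym)
      then have "[r' * i = r' * j] (mod q')" by (simp only: cong_int_iff)
      then have "[i = j] (mod q')"
        using qr(3) by (simp add: cong_mult_lcancel_nat coprime_commute)
      then have "i mod q' = j mod q'" by (simp add: cong_def)
      then show "i = j" using ij(3) by (metis div_mult_mod_eq)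
    qed
    then have "card (C k) = card ((\<lambda>j. j div q') ` C k)" by (simp add: card_image)
    also have "\<dots> \<le> card {..<?d}"
    proof (rule card_mono)
      have "j div q' < ?d" if "j < ?d * q'" for j
        using that by (simp add: less_mult_imp_div_less)
      then show "(\<lambda>j. j div q') ` C k \<subseteq> {..<?d}" using qr(1) by (auto simp: C_def)
    qed simp
    finally show ?thesis by simp
  qed
  have "{j\<in>{..<q}. dist_int (x + real (r * j) / real q) < \<delta>} \<subseteq> (\<Union>k\<in>K. C k)"
  proof
    fix j assume "j \<in> {j\<in>{..<q}. dist_int (x + real (r * j) / real q) < \<delta>}"
    then obtain n :: int where j: "j < q" and n: "\<bar>x + real (r * j) / real q - of_int n\<bar> < \<delta>"
      by (auto simp: dist_int_less_iff)
    have "real (r * j) / real q = real (?d * r' * j) / real (?d * q')"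
      using qr(1,2) by metis
    also have "\<dots> = real (r' * j) / real q'"
    proof -
      have "real ?d \<noteq> 0" using d by linarith
      then show ?thesis unfolding of_nat_mult mult.assoc by (rule mult_divide_mult_cancel_left)
    qed
    finally have "real (r * j) / real q = real (r' * j) / real q'" .
    then have "\<bar>x + real (r' * j) / real q' - of_int n\<bar> * real q' < \<delta> * real q'"
      using n q' by (intro mult_strict_right_mono) auto
    also have "\<bar>x + real (r' * j) / real q' - of_int n\<bar> * real q'
        = \<bar>(x + real (r' * j) / real q' - of_int n) * real q'\<bar>" by (simp add: abs_mult)
    also have "(x + real (r' * j) / real q' - of_int n) * real q'
        = real q' * x + of_int (int (r' * j) - n * int q')"
      using q' by (simp add: algebra_simps)
    finally have "int (r' * j) - n * int q' \<in> K" by (auto simp: K_def abs_less_iff)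
    moreover have "j \<in> C (int (r' * j) - n * int q')"
      using j by (simp add: C_def cong_iff_dvd_diff)
    ultimately show "j \<in> (\<Union>k\<in>K. C k)" by blast
  qed
  then have "card {j\<in>{..<q}. dist_int (x + real (r * j) / real q) < \<delta>} \<le> card (\<Union>k\<in>K. C k)"
    by (intro card_mono) (auto simp: finK C_def)
  also have "\<dots> \<le> (\<Sum>k\<in>K. card (C k))" by (rule card_UN_le[OF finK])
  also have "\<dots> \<le> card K * ?d" using sum_bounded_above[of K "\<lambda>k. card (C k)" ?d] card_C by simp
  finally have "real (card {j\<in>{..<q}. dist_int (x + real (r * j) / real q) < \<delta>}) \<le> real (card K) * real ?d"
    by (simp only: of_nat_mult[symmetric] of_nat_le_iff)
  also have "\<dots> \<le> (2 * \<delta> * real q' + 1) * real ?d"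
    by (intro mult_right_mono cardK) simp
  also have "\<dots> = 2 * \<delta> * real (?d * q') + real ?d" by (simp add: algebra_simps)
  finally show ?thesis using qr(1) by simp
qed

section \<open>Integrals of functions of period 1\<close>

lemma nn_integral_unit_split:
  fixes h :: "real \<Rightarrow> ennreal"
  assumes [measurable]: "h \<in> borel_measurable borel" and q: "q \<ge> (1::nat)"
  shows "(\<integral>\<^sup>+x\<in>{0..<1}. h x \<partial>lborel)
    = (\<Sum>j<q. \<integral>\<^sup>+x\<in>{0..<1 / real q}. h (x + real j / real q) \<partial>lborel)"
proof -
  have ind: "(\<Sum>j<n. indicator {real j / real q..<real (Suc j) / real q} x)
      = (indicator {0..<real n / real q} x :: ennreal)" for x and n
  proof (induction n)
    case (Suc n)
    define u v where "u = real n / real q" and "v = real (Suc n) / real q"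
    have "u \<le> v" "0 \<le> u"
      by (auto simp: u_def v_def intro: divide_right_mono)
    then have "indicator {0..<v} x = indicator {0..<u} x + (indicator {u..<v} x :: ennreal)"
      by (auto simp: indicator_def)
    then have "indicator {0..<real (Suc n) / real q} x
        = indicator {0..<real n / real q} x + (indicator {real n / real q..<real (Suc n) / real q} x :: ennreal)"
      by (simp only: u_def v_def)
    then show ?case using Suc by simp
  qed simp
  have "(\<integral>\<^sup>+x\<in>{0..<1}. h x \<partial>lborel)
      = (\<integral>\<^sup>+x. (\<Sum>j<q. h x * indicator {real j / real q..<real (Suc j) / real q} x) \<partial>lborel)"
    unfolding sum_distrib_left[symmetric] ind using q by simp
  also have "\<dots> = (\<Sum>j<q. \<integral>\<^sup>+x\<in>{real j / real q..<real (Suc j) / real q}. h x \<partial>lborel)"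
    by (rule nn_integral_sum) simp
  also have "\<dots> = (\<Sum>j<q. \<integral>\<^sup>+x\<in>{0..<1 / real q}. h (x + real j / real q) \<partial>lborel)"
  proof (rule sum.cong[OF refl])
    fix j
    have "indicator {real j / real q..<real (Suc j) / real q} (real j / real q + x)
        = (indicator {0..<1 / real q} x :: ennreal)" for x
      by (auto simp: indicator_def add_divide_distrib)
    then show "(\<integral>\<^sup>+x\<in>{real j / real q..<real (Suc j) / real q}. h x \<partial>lborel)
        = (\<integral>\<^sup>+x\<in>{0..<1 / real q}. h (x + real j / real q) \<partial>lborel)"
      by (subst nn_integral_real_affine[where c = 1 and t = "real j / real q"]) (auto simp: add.commute)
  qed
  finally show ?thesis .
qed

lemma nn_integral_shift_int:
  fixes h :: "real \<Rightarrow> ennreal"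
  assumes [measurable]: "h \<in> borel_measurable borel" and "\<And>x. h (x + of_int k) = h x"
  shows "(\<integral>\<^sup>+x\<in>{u..<v}. h x \<partial>lborel) = (\<integral>\<^sup>+x\<in>{u + of_int k..<v + of_int k}. h x \<partial>lborel)"
proof -
  have "indicator {u + of_int k..<v + of_int k} (of_int k + x) = (indicator {u..<v} x :: ennreal)" for x
    by (auto simp: indicator_def)
  then show ?thesis
    by (subst (2) nn_integral_real_affine[where c = 1 and t = "of_int k"])
       (auto simp: assms(2) add.commute[of "of_int k"])
qed

lemma nn_integral_periodic:
  fixes h :: "real \<Rightarrow> ennreal"
  assumes [measurable]: "h \<in> borel_measurable borel" and per: "\<And>x k. h (x + of_int k) = h x"
  shows "(\<integral>\<^sup>+x\<in>{a..<a + 1}. h x \<partial>lborel) = (\<integral>\<^sup>+x\<in>{0..<1}. h x \<partial>lborel)"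
proof -
  let ?I = "\<lambda>u v. \<integral>\<^sup>+x\<in>{u..<v}. h x \<partial>lborel"
  have split: "?I u w = ?I u v + ?I v w" if "u \<le> v" "v \<le> w" for u v w
  proof -
    have "indicator {u..<w} x = indicator {u..<v} x + (indicator {v..<w} x :: ennreal)" for x
      using that by (auto simp: indicator_def)
    then show ?thesis by (simp add: distrib_left nn_integral_add)
  qed
  \<comment> \<open>Cut at the integer m: the left piece moves by 1 - m and the right piece by - m,
    and together they tile [0, 1) in the opposite order.\<close>
  define m where "m = \<lceil>a\<rceil>"
  have m: "a \<le> of_int m" "of_int m \<le> a + 1" unfolding m_def by linarith+
  have "?I a (a + 1) = ?I a (of_int m) + ?I (of_int m) (a + 1)" by (rule split) (use m in auto)
  also have "?I a (of_int m) = ?I (a + of_int (1 - m)) (of_int m + of_int (1 - m))"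
    by (rule nn_integral_shift_int[OF assms(1) per])
  also have "?I (of_int m) (a + 1) = ?I (of_int m + of_int (- m)) (a + 1 + of_int (- m))"
    by (rule nn_integral_shift_int[OF assms(1) per])
  also have "?I (a + of_int (1 - m)) (of_int m + of_int (1 - m)) + ?I (of_int m + of_int (- m)) (a + 1 + of_int (- m))
      = ?I 0 (a + 1 - of_int m) + ?I (a + 1 - of_int m) 1"
    by (simp add: add.commute algebra_simps)
  also have "\<dots> = ?I 0 1" by (rule split[symmetric]) (use m in auto)
  finally show ?thesis .
qed

text \<open>Periodicity permits integration over the unit window centred at \<gamma>, where, because
  \<delta> <= 1/2, the integer 0 is the only one that can be within \<delta>.\<close>

lemma nn_integral_dist_int:
  assumes "0 \<le> \<delta>" "\<delta> \<le> 1 / 2"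
  shows "(\<integral>\<^sup>+x\<in>{0..<1}. indicator {x. dist_int x < \<delta>} (x - \<gamma>) \<partial>lborel) = ennreal (2 * \<delta>)"
proof -
  let ?h = "\<lambda>x. indicator {x. dist_int x < \<delta>} (x - \<gamma>) :: ennreal"
  have shift: "x + of_int k - \<gamma> = (x - \<gamma>) + of_int k" for x and k :: int by simp
  have per: "?h (x + of_int k) = ?h x" for x k
    unfolding shift by (simp add: indicator_def dist_int_less_add_int)
  have "(\<integral>\<^sup>+x\<in>{0..<1}. ?h x \<partial>lborel) = (\<integral>\<^sup>+x\<in>{\<gamma> - 1 / 2..<\<gamma> - 1 / 2 + 1}. ?h x \<partial>lborel)"
    by (rule nn_integral_periodic[symmetric]) (auto simp: per)
  also have "\<dots> = (\<integral>\<^sup>+x. indicator {\<gamma> - \<delta><..<\<gamma> + \<delta>} x \<partial>lborel)"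
  proof (rule nn_integral_cong)
    fix x
    have "dist_int (x - \<gamma>) < \<delta> \<longleftrightarrow> \<bar>x - \<gamma>\<bar> < \<delta>" if "- 1 / 2 \<le> x - \<gamma>" "x - \<gamma> < 1 / 2"
    proof
      assume "dist_int (x - \<gamma>) < \<delta>"
      then obtain n :: int where n: "\<bar>x - \<gamma> - of_int n\<bar> < \<delta>" by (auto simp: dist_int_less_iff)
      then have "\<bar>x - \<gamma> - of_int n\<bar> < 1 / 2" using assms by simp
      then have "of_int n < (1::real)" "of_int n > (- 1::real)" using that by linarith+
      then have "n = 0" by simp
      then show "\<bar>x - \<gamma>\<bar> < \<delta>" using n by simp
    next
      assume "\<bar>x - \<gamma>\<bar> < \<delta>"
      then show "dist_int (x - \<gamma>) < \<delta>" unfolding dist_int_less_iff by (intro exI[of _ 0]) simp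
    qed
    then show "?h x * indicator {\<gamma> - 1 / 2..<\<gamma> - 1 / 2 + 1} x = indicator {\<gamma> - \<delta><..<\<gamma> + \<delta>} x"
      using assms by (auto simp: indicator_def abs_less_iff)
  qed
  also have "\<dots> = emeasure lborel {\<gamma> - \<delta><..<\<gamma> + \<delta>}" by simp
  also have "\<dots> = ennreal (2 * \<delta>)" using assms by simp
  finally show ?thesis .
qed

lemma nn_integral_dist_int_mult:
  assumes "0 \<le> \<delta>" "\<delta> \<le> 1 / 2" "q \<ge> (1::nat)"
  shows "(\<integral>\<^sup>+x\<in>{0..<1 / real q}. indicator {x. dist_int x < \<delta>} (real q * x - \<gamma>) \<partial>lborel)
    = ennreal (2 * \<delta> / real q)"
proof -
  have ind: "indicator {0..<1 / real q} ((1 / real q) * x) = (indicator {0..<1} x :: ennreal)" for x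
    using assms by (auto simp: indicator_def field_simps)
  have "(\<integral>\<^sup>+x\<in>{0..<1 / real q}. indicator {x. dist_int x < \<delta>} (real q * x - \<gamma>) \<partial>lborel)
      = ennreal (1 / real q) * (\<integral>\<^sup>+x\<in>{0..<1}. indicator {x. dist_int x < \<delta>} (x - \<gamma>) \<partial>lborel)"
    using assms ind
    by (subst nn_integral_real_affine[where c = "1 / real q" and t = 0]) auto
  also have "\<dots> = ennreal (2 * \<delta> / real q)"
    using assms by (subst nn_integral_dist_int) (auto simp: ennreal_mult[symmetric])
  finally show ?thesis .
qed

text \<open>Half-open, so that q cells of length 1 / q tile [0, 1) exactly. The endpoint 1 allowed
  by \<open>W\<close> is handled as a null set in \<open>emeasure_W_eq_1\<close>.\<close>

definition approx_set :: "nat \<Rightarrow> real \<Rightarrow> real \<Rightarrow> real set" where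
  "approx_set q \<gamma> \<delta> = {\<alpha>\<in>{0..<1}. dist_int (real q * \<alpha> - \<gamma>) < \<delta>}"

lemma approx_set_borel [measurable]: "approx_set q \<gamma> \<delta> \<in> sets borel"
  unfolding approx_set_def by measurable

lemma emeasure_approx_set:
  assumes "0 \<le> \<delta>" "\<delta> \<le> 1 / 2" "q \<ge> 1"
  shows "emeasure lborel (approx_set q \<gamma> \<delta>) = ennreal (2 * \<delta>)"
proof -
  let ?h = "indicator {x. dist_int x < \<delta>} :: real \<Rightarrow> ennreal"
  have "emeasure lborel (approx_set q \<gamma> \<delta>) = (\<integral>\<^sup>+x. indicator (approx_set q \<gamma> \<delta>) x \<partial>lborel)" by simp
  also have "\<dots> = (\<integral>\<^sup>+x\<in>{0..<1}. ?h (real q * x - \<gamma>) \<partial>lborel)"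
    by (intro nn_integral_cong) (auto simp: approx_set_def indicator_def)
  also have "\<dots> = (\<Sum>j<q. \<integral>\<^sup>+x\<in>{0..<1 / real q}. ?h (real q * (x + real j / real q) - \<gamma>) \<partial>lborel)"
    by (rule nn_integral_unit_split) (use assms in auto)
  also have "\<dots> = (\<Sum>j<q. \<integral>\<^sup>+x\<in>{0..<1 / real q}. ?h (real q * x - \<gamma>) \<partial>lborel)"
  proof (intro sum.cong refl nn_integral_cong)
    fix j x
    have "real q * (x + real j / real q) - \<gamma> = (real q * x - \<gamma>) + of_int (int j)"
      using assms by (simp add: field_simps)
    then have "?h (real q * (x + real j / real q) - \<gamma>) = ?h (real q * x - \<gamma>)"
      by (simp only: indicator_def mem_Collect_eq dist_int_less_add_int)
    then show "?h (real q * (x + real j / real q) - \<gamma>) * indicator {0..<1 / real q} x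
        = ?h (real q * x - \<gamma>) * indicator {0..<1 / real q} x" by simp
  qed
  also have "\<dots> = of_nat q * ennreal (2 * \<delta> / real q)"
    using nn_integral_dist_int_mult[OF assms] by simp
  also have "\<dots> = ennreal (2 * \<delta>)"
    using assms by (simp add: ennreal_of_nat_eq_real_of_nat ennreal_mult[symmetric])
  finally show ?thesis .
qed

text \<open>Cutting $[0, 1)$ into $q$ intervals of length $1/q$ leaves the first condition unchanged
  and moves the second one along the orbit of the rotation by $r/q$.\<close>
lemma emeasure_approx_set_Int_le:
  assumes "0 \<le> \<delta>" "\<delta> \<le> 1 / 2" "q \<ge> 1" "0 \<le> \<eta>"
  shows "emeasure lborel (approx_set q \<gamma> \<delta> \<inter> approx_set r \<beta> \<eta>)
    \<le> ennreal (2 * \<delta> * (2 * \<eta> + real (gcd q r) / real q))"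
proof -
  let ?h = "indicator {x. dist_int x < \<delta>} :: real \<Rightarrow> ennreal"
  let ?k = "indicator {x. dist_int x < \<eta>} :: real \<Rightarrow> ennreal"
  let ?c = "2 * \<eta> * real q + real (gcd q r)"
  have "emeasure lborel (approx_set q \<gamma> \<delta> \<inter> approx_set r \<beta> \<eta>)
      = (\<integral>\<^sup>+x. indicator (approx_set q \<gamma> \<delta> \<inter> approx_set r \<beta> \<eta>) x \<partial>lborel)" by simp
  also have "\<dots> = (\<integral>\<^sup>+x\<in>{0..<1}. (?h (real q * x - \<gamma>) * ?k (real r * x - \<beta>)) \<partial>lborel)"
    by (intro nn_integral_cong) (auto simp: approx_set_def indicator_def)
  also have "\<dots> = (\<Sum>j<q. \<integral>\<^sup>+x\<in>{0..<1 / real q}.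
      (?h (real q * (x + real j / real q) - \<gamma>) * ?k (real r * (x + real j / real q) - \<beta>)) \<partial>lborel)"
    by (rule nn_integral_unit_split) (use assms in auto)
  also have "\<dots> = (\<Sum>j<q. \<integral>\<^sup>+x\<in>{0..<1 / real q}.
      (?h (real q * x - \<gamma>) * ?k (real r * x - \<beta> + real (r * j) / real q)) \<partial>lborel)"
  proof (intro sum.cong refl nn_integral_cong)
    fix j x
    have "real q * (x + real j / real q) - \<gamma> = (real q * x - \<gamma>) + of_int (int j)"
      using assms by (simp add: field_simps)
    then have "?h (real q * (x + real j / real q) - \<gamma>) = ?h (real q * x - \<gamma>)"
      by (simp only: indicator_def mem_Collect_eq dist_int_less_add_int)
    moreover have "real r * (x + real j / real q) - \<beta> = real r * x - \<beta> + real (r * j) / real q"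
      by (simp add: algebra_simps)
    ultimately show "?h (real q * (x + real j / real q) - \<gamma>) * ?k (real r * (x + real j / real q) - \<beta>) * indicator {0..<1 / real q} x
        = ?h (real q * x - \<gamma>) * ?k (real r * x - \<beta> + real (r * j) / real q) * indicator {0..<1 / real q} x" by (simp only:)
  qed
  \<comment> \<open>With the sum under the integral, the orbit count applies for each fixed x,
    uniformly in x, and only the condition on q remains to be integrated.\<close>
  also have "\<dots> = (\<integral>\<^sup>+x. (\<Sum>j<q. ?h (real q * x - \<gamma>) * ?k (real r * x - \<beta> + real (r * j) / real q)
      * indicator {0..<1 / real q} x) \<partial>lborel)"
    by (rule nn_integral_sum[symmetric]) simp
  also have "\<dots> \<le> (\<integral>\<^sup>+x. ennreal ?c * (?h (real q * x - \<gamma>) * indicator {0..<1 / real q} x) \<partial>lborel)"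
  proof (rule nn_integral_mono)
    fix x
    let ?y = "real r * x - \<beta>"
    have "(\<Sum>j<q. ?k (?y + real (r * j) / real q))
        = of_nat (card {j\<in>{..<q}. dist_int (?y + real (r * j) / real q) < \<eta>})"
      by (simp add: indicator_def sum.If_cases Int_def)
    also have "\<dots> \<le> ennreal ?c"
      unfolding ennreal_of_nat_eq_real_of_nat
      by (intro ennreal_leI card_dist_int_orbit_le assms)
    finally have "(\<Sum>j<q. ?k (?y + real (r * j) / real q)) \<le> ennreal ?c" .
    then have "(\<Sum>j<q. ?k (?y + real (r * j) / real q)) * (?h (real q * x - \<gamma>) * indicator {0..<1 / real q} x)
        \<le> ennreal ?c * (?h (real q * x - \<gamma>) * indicator {0..<1 / real q} x)"
      by (rule mult_right_mono) simp
    moreover have "(\<Sum>j<q. ?h (real q * x - \<gamma>) * ?k (?y + real (r * j) / real q) * indicator {0..<1 / real q} x)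
        = (\<Sum>j<q. ?k (?y + real (r * j) / real q)) * (?h (real q * x - \<gamma>) * indicator {0..<1 / real q} x)"
      unfolding sum_distrib_right by (intro sum.cong refl) (simp only: mult_ac)
    ultimately show "(\<Sum>j<q. ?h (real q * x - \<gamma>) * ?k (?y + real (r * j) / real q) * indicator {0..<1 / real q} x)
        \<le> ennreal ?c * (?h (real q * x - \<gamma>) * indicator {0..<1 / real q} x)"
      by (simp only:)
  qed
  also have "\<dots> = ennreal ?c * ennreal (2 * \<delta> / real q)"
    using nn_integral_dist_int_mult[OF assms(1-3)] by (subst nn_integral_cmult) auto
  also have "\<dots> = ennreal (2 * \<delta> * (2 * \<eta> + real (gcd q r) / real q))"
  proof -
    have "ennreal ?c * ennreal (2 * \<delta> / real q) = ennreal (?c * (2 * \<delta> / real q))"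
      using assms by (intro ennreal_mult[symmetric]) auto
    also have "?c * (2 * \<delta> / real q) = 2 * \<delta> * (2 * \<eta> + real (gcd q r) / real q)"
      using assms by (simp add: field_simps)
    finally show ?thesis .
  qed
  finally show ?thesis .
qed

subsection \<open>Second moment\<close>

text \<open>Off all the sets \<open>B q\<close> the weighted count is 0, so its squared deviation
  from the mean \<mu> is exactly \<mu>^2 there. Integrating that deviation gives the variance on the
  right.\<close>

lemma (in prob_space) second_moment_avoid_le:
  fixes w :: "'b \<Rightarrow> real"
  assumes fin: "finite S" and B: "\<And>q. q \<in> S \<Longrightarrow> B q \<in> events"
  defines "\<mu> \<equiv> \<Sum>q\<in>S. w q * prob (B q)"
  shows "prob (space M - (\<Union>q\<in>S. B q)) * \<mu>\<^sup>2 \<le> (\<Sum>q\<in>S. \<Sum>r\<in>S. w q * w r * prob (B q \<inter> B r)) - \<mu>\<^sup>2"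
proof -
  let ?Z = "space M - (\<Union>q\<in>S. B q)"
  let ?f = "\<lambda>x. \<Sum>q\<in>S. w q * indicator (B q) x"
  \<comment> \<open>The squared deviation in expanded form, ready to be integrated term by
    term.\<close>
  let ?g = "\<lambda>x. (\<Sum>q\<in>S. \<Sum>r\<in>S. w q * w r * indicator (B q \<inter> B r) x) - 2 * \<mu> * ?f x + \<mu>\<^sup>2"
  have Z: "?Z \<in> events" using fin B by auto
  have int: "integrable M (indicator A :: 'a \<Rightarrow> real)" if "A \<in> events" for A
    by (rule integrable_real_indicator) (use that in \<open>auto simp: less_top[symmetric]\<close>)
  have BB: "B q \<inter> B r \<in> events" if "q \<in> S" "r \<in> S" for q r using that B by auto
  have int_f: "integrable M ?f" by (intro Bochner_Integration.integrable_sum integrable_mult_right int B)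
  have int_ff: "integrable M (\<lambda>x. \<Sum>q\<in>S. \<Sum>r\<in>S. w q * w r * indicator (B q \<inter> B r) x)"
    by (intro Bochner_Integration.integrable_sum integrable_mult_right int BB)
  have "prob ?Z * \<mu>\<^sup>2 = (\<integral>x. indicator ?Z x * \<mu>\<^sup>2 \<partial>M)" using Z by (simp add: Int_absorb2)
  also have "\<dots> \<le> (\<integral>x. ?g x \<partial>M)"
  proof (rule integral_mono)
    show "integrable M (\<lambda>x. indicator ?Z x * \<mu>\<^sup>2)" by (intro integrable_mult_left int Z)
    show "integrable M ?g"
      by (intro Bochner_Integration.integrable_add Bochner_Integration.integrable_diff int_ff
        integrable_mult_right int_f) simp
  next
    fix x assume "x \<in> space M"
    have "?g x = (?f x)\<^sup>2 - 2 * \<mu> * ?f x + \<mu>\<^sup>2"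
      by (simp add: power2_eq_square sum_product indicator_inter_arith mult_ac)
    also have "\<dots> = (?f x - \<mu>)\<^sup>2" by (simp add: power2_eq_square algebra_simps)
    finally have g: "?g x = (?f x - \<mu>)\<^sup>2" .
    show "indicator ?Z x * \<mu>\<^sup>2 \<le> ?g x"
    proof (cases "x \<in> ?Z")
      case True
      then have "?f x = 0" by (intro sum.neutral) auto
      then show ?thesis unfolding g using True by simp
    qed (simp add: g)
  qed
  also have "\<dots> = (\<Sum>q\<in>S. \<Sum>r\<in>S. w q * w r * prob (B q \<inter> B r)) - 2 * \<mu> * \<mu> + \<mu>\<^sup>2"
  proof -
    have "(\<integral>x. ?f x \<partial>M) = \<mu>"
      unfolding \<mu>_def by (subst Bochner_Integration.integral_sum)
        (auto intro!: integrable_mult_right int B sum.cong simp: B sets.sets_into_space Int_absorb2)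
    moreover have "(\<integral>x. (\<Sum>q\<in>S. \<Sum>r\<in>S. w q * w r * indicator (B q \<inter> B r) x) \<partial>M)
        = (\<Sum>q\<in>S. \<Sum>r\<in>S. w q * w r * prob (B q \<inter> B r))"
    proof (subst Bochner_Integration.integral_sum)
      fix q assume "q \<in> S"
      then show "integrable M (\<lambda>x. \<Sum>r\<in>S. w q * w r * indicator (B q \<inter> B r) x)"
        by (intro Bochner_Integration.integrable_sum integrable_mult_right int BB)
    next
      have "(\<integral>x. (\<Sum>r\<in>S. w q * w r * indicator (B q \<inter> B r) x) \<partial>M) = (\<Sum>r\<in>S. w q * w r * prob (B q \<inter> B r))"
        if q: "q \<in> S" for q
      proof (subst Bochner_Integration.integral_sum)
        fix r assume "r \<in> S"
        then show "integrable M (\<lambda>x. w q * w r * indicator (B q \<inter> B r) x)"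
          using q by (intro integrable_mult_right int BB)
      next
        show "(\<Sum>r\<in>S. \<integral>x. w q * w r * indicator (B q \<inter> B r) x \<partial>M) = (\<Sum>r\<in>S. w q * w r * prob (B q \<inter> B r))"
        proof (rule sum.cong[OF refl])
          fix r assume "r \<in> S"
          then have "B q \<inter> B r \<inter> space M = B q \<inter> B r" using BB[OF q] sets.sets_into_space by blast
          then show "(\<integral>x. w q * w r * indicator (B q \<inter> B r) x \<partial>M) = w q * w r * prob (B q \<inter> B r)" by simp
        qed
      qed
      then show "(\<Sum>q\<in>S. \<integral>x. (\<Sum>r\<in>S. w q * w r * indicator (B q \<inter> B r) x) \<partial>M)
          = (\<Sum>q\<in>S. \<Sum>r\<in>S. w q * w r * prob (B q \<inter> B r))" by (intro sum.cong refl)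
    qed
    ultimately show ?thesis
      using int_f int_ff by (simp add: prob_space)
  qed
  finally show ?thesis by (simp add: power2_eq_square)
qed

text \<open>The overlap bound gcd(q, r) / q is better when q is the larger index, so the symmetric
  sum is folded onto r <= q. As g is nonnegative, counting the diagonal twice and extending the
  range down to 1 are harmless; E itself may be negative.\<close>

lemma sum_sym_le:
  fixes g :: "nat \<Rightarrow> nat \<Rightarrow> real"
  assumes "\<And>q r. g q r \<ge> 0" "n0 \<ge> 1"
    and "\<And>q r. 1 \<le> r \<Longrightarrow> r \<le> q \<Longrightarrow> E q r \<le> g q r" "\<And>q r. E q r = E r q"
  shows "(\<Sum>q=n0..N. \<Sum>r=n0..N. E q r) \<le> 2 * (\<Sum>q=1..N. \<Sum>r=1..q. g q r)"
proof -
  let ?G = "\<lambda>q r. if r \<le> q then g q r else 0"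
  have "(\<Sum>q=n0..N. \<Sum>r=n0..N. E q r) \<le> (\<Sum>q=n0..N. \<Sum>r=n0..N. ?G q r + ?G r q)"
  proof (intro sum_mono)
    fix q r assume qr: "q \<in> {n0..N}" "r \<in> {n0..N}"
    show "E q r \<le> ?G q r + ?G r q"
    proof (cases "r \<le> q")
      case True
      then have "E q r \<le> g q r" by (intro assms(3)) (use qr assms(2) in auto)
      then show ?thesis using True assms(1)[of r q] by auto
    next
      case False
      then have "E r q \<le> g r q" by (intro assms(3)) (use qr assms(2) in auto)
      then show ?thesis using False assms(4)[of q r] by auto
    qed
  qed
  also have "\<dots> = (\<Sum>q=n0..N. \<Sum>r=n0..N. ?G q r) + (\<Sum>q=n0..N. \<Sum>r=n0..N. ?G r q)"
    by (simp only: sum.distrib)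
  also have "(\<Sum>q=n0..N. \<Sum>r=n0..N. ?G r q) = (\<Sum>q=n0..N. \<Sum>r=n0..N. ?G q r)"
    by (rule sum.swap)
  also have "(\<Sum>q=n0..N. \<Sum>r=n0..N. ?G q r) \<le> (\<Sum>q=1..N. \<Sum>r=1..q. g q r)"
  proof -
    have "(\<Sum>q=n0..N. \<Sum>r=n0..N. ?G q r) \<le> (\<Sum>q=n0..N. \<Sum>r=1..q. g q r)"
    proof (rule sum_mono)
      fix q assume "q \<in> {n0..N}"
      have "(\<Sum>r=n0..N. ?G q r) = (\<Sum>r\<in>{r\<in>{n0..N}. r \<le> q}. g q r)"
        by (intro sum.inter_filter[symmetric]) simp
      also have "\<dots> \<le> (\<Sum>r=1..q. g q r)"
        by (intro sum_mono2) (use assms in auto)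
      finally show "(\<Sum>r=n0..N. ?G q r) \<le> (\<Sum>r=1..q. g q r)" .
    qed
    also have "\<dots> \<le> (\<Sum>q=1..N. \<Sum>r=1..q. g q r)"
      by (intro sum_mono2) (use assms in \<open>auto intro!: sum_nonneg\<close>)
    finally show ?thesis .
  qed
  finally show ?thesis by simp
qed

section \<open>Truncated logarithms and the variance estimate\<close>

lemma tlog_ge_1: "1 \<le> tlog x"
  by (simp add: tlog_def)

lemma tlog_mono: "0 < x \<Longrightarrow> x \<le> y \<Longrightarrow> tlog x \<le> tlog y"
  unfolding tlog_def by (intro max.mono order.refl) simp

lemma iter_tlog_ge_1: "k \<ge> 1 \<Longrightarrow> 1 \<le> (tlog ^^ k) x"
  by (cases k) (auto simp: tlog_ge_1)

text \<open>Divergence ensures that the indices below a fixed n0 eventually carry at most half of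
  the sum, as \<open>measure_avoid_le\<close> requires.\<close>

lemma logsum_sqf_weight_at_top: "filterlim (logsum sqf_weight) at_top sequentially"
proof (rule filterlim_at_top_mono)
  show "filterlim (\<lambda>N::nat. sqrt (ln (real N) / 2)) at_top sequentially" by real_asymp
  show "\<forall>\<^sub>F N in sequentially. sqrt (ln (real N) / 2) \<le> logsum sqf_weight N"
    using eventually_ge_at_top[of 1]
  proof eventually_elim
    case (elim N)
    then have "sqrt (ln (real N) / 2) \<le> sqrt ((logsum sqf_weight N)\<^sup>2)"
      using logsum_sqf_weight_ge by (intro real_sqrt_le_mono) auto
    also have "\<dots> = logsum sqf_weight N"
      using logsum_sqf_weight_ge_1[OF elim] by simp
    finally show ?case .
  qed
qed

lemma prob_space_unit_interval: "prob_space (restrict_space lborel {0..<1::real})"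
  by (intro prob_spaceI) (simp add: space_restrict_space emeasure_restrict_space)

text \<open>The squared mean is at least c^2 / 2 and the variance at most 4 c times the bracket,
  hence the factor 8 / c. The condition c <= 1/2 together with ln N >= 1, from N >= 3, keeps every
  radius in the range of the exact measure formula.\<close>

lemma measure_avoid_le:
  assumes c: "0 < c" "c \<le> 1 / 2" and n0: "n0 \<ge> 1" and N: "N \<ge> 3"
    and G: "2 * logsum sqf_weight (n0 - 1) \<le> logsum sqf_weight N"
  shows "measure lborel ({0..<1} - (\<Union>q\<in>{n0..N}. approx_set q (\<gamma> q) (c / (real q * sqrt (ln (real N))))))
    \<le> 8 / c * ((1 + 4 * ln (real N)) powr (1 / 4) * (1 + 8 * ln (1 + 2 * ln (real N))) / sqrt (ln (real N)))"
proof -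
  define M where "M = restrict_space lborel {0..<1::real}"
  interpret prob_space M unfolding M_def by (rule prob_space_unit_interval)
  define L where "L = ln (real N)"
  define \<delta> where "\<delta> q = c / (real q * sqrt L)" for q :: nat
  define B where "B q = approx_set q (\<gamma> q) (\<delta> q)" for q
  have L: "L \<ge> 1"
  proof -
    have "exp 1 \<le> real N" using exp_le N by simp
    then show ?thesis unfolding L_def using N by (subst ln_ge_iff) auto
  qed
  have \<delta>: "0 \<le> \<delta> q" "\<delta> q \<le> 1 / 2" if "q \<ge> 1" for q
  proof -
    have "1 * 1 \<le> real q * sqrt L" using that L by (intro mult_mono) auto
    then have "\<delta> q \<le> c / 1" unfolding \<delta>_def using c by (intro divide_left_mono) auto
    then show "\<delta> q \<le> 1 / 2" using c by simp
    show "0 \<le> \<delta> q" using c L by (simp add: \<delta>_def)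
  qed
  have B_sub: "B q \<subseteq> {0..<1}" for q by (auto simp: B_def approx_set_def)
  have B_ev: "B q \<in> events" for q
    using B_sub by (simp add: M_def sets_restrict_space_iff B_def)
  have prob_eq: "prob A = measure lborel A" if "A \<subseteq> {0..<1}" for A
    unfolding M_def using that by (simp add: measure_restrict_space)
  have prob_B: "prob (B q) = 2 * \<delta> q" if "q \<ge> 1" for q
  proof -
    have "prob (B q) = measure lborel (B q)" by (rule prob_eq[OF B_sub])
    also have "\<dots> = 2 * \<delta> q"
      using \<delta>[OF that] that by (simp add: measure_def B_def emeasure_approx_set)
    finally show ?thesis .
  qed
  have prob_BB: "prob (B q \<inter> B r) \<le> 2 * \<delta> q * (2 * \<delta> r + real (gcd q r) / real q)" if "q \<ge> 1" "r \<ge> 1" for q r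
  proof -
    have "emeasure lborel (B q \<inter> B r) \<le> ennreal (2 * \<delta> q * (2 * \<delta> r + real (gcd q r) / real q))"
      unfolding B_def using \<delta> that by (intro emeasure_approx_set_Int_le) auto
    moreover have "2 * \<delta> q * (2 * \<delta> r + real (gcd q r) / real q) \<ge> 0"
      using \<delta> that by (intro mult_nonneg_nonneg add_nonneg_nonneg) auto
    ultimately have "measure lborel (B q \<inter> B r) \<le> 2 * \<delta> q * (2 * \<delta> r + real (gcd q r) / real q)"
      unfolding measure_def by (metis enn2real_leI)
    moreover have "B q \<inter> B r \<subseteq> {0..<1}" using B_sub by blast
    ultimately show ?thesis by (simp add: prob_eq)
  qed
  let ?G = "logsum sqf_weight" and ?w = sqf_weight
  define \<mu> where "\<mu> = (\<Sum>q=n0..N. ?w q * prob (B q))"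
  have "\<mu> = (\<Sum>q=n0..N. 2 * c / sqrt L * (?w q / real q))"
    unfolding \<mu>_def using n0 by (intro sum.cong) (auto simp: prob_B \<delta>_def mult_ac)
  also have "\<dots> = 2 * c / sqrt L * (\<Sum>q=n0..N. ?w q / real q)" by (simp add: sum_distrib_left)
  finally have \<mu>_eq: "\<mu> = 2 * c / sqrt L * (\<Sum>q=n0..N. ?w q / real q)" .
  have "?G N \<le> (\<Sum>q\<in>{1..n0 - 1} \<union> {n0..N}. ?w q / real q)"
    unfolding logsum_def by (intro sum_mono2) (auto simp: sqf_weight_nonneg)
  also have "\<dots> = ?G (n0 - 1) + (\<Sum>q=n0..N. ?w q / real q)"
    unfolding logsum_def by (intro sum.union_disjoint) (use n0 in auto)
  finally have "?G N / 2 \<le> (\<Sum>q=n0..N. ?w q / real q)" using G by simp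
  then have "2 * c / sqrt L * (?G N / 2) \<le> \<mu>"
    unfolding \<mu>_eq using c L by (intro mult_left_mono) auto
  then have "(c / sqrt L * ?G N)\<^sup>2 \<le> \<mu>\<^sup>2"
    using c L logsum_sqf_weight_ge_1[of N] N by (intro power_mono) auto
  \<comment> \<open>The factor sqrt L in the radius cancels exactly against G^2 >= L / 2, so the
    bound is independent of N.\<close>
  moreover have "c\<^sup>2 / 2 \<le> (c / sqrt L * ?G N)\<^sup>2"
  proof -
    have "c\<^sup>2 / 2 = c\<^sup>2 / L * (L / 2)" using L by simp
    also have "\<dots> \<le> c\<^sup>2 / L * (?G N)\<^sup>2"
      using logsum_sqf_weight_ge[of N] N L by (intro mult_left_mono) (auto simp: L_def)
    also have "\<dots> = (c / sqrt L * ?G N)\<^sup>2" using L by (simp add: power_mult_distrib power_divide)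
    finally show ?thesis .
  qed
  ultimately have \<mu>_ge: "c\<^sup>2 / 2 \<le> \<mu>\<^sup>2" by linarith
  \<comment> \<open>Weighted covariances, and the part of them that survives on r <= q.\<close>
  define E where "E q r = ?w q * ?w r * (prob (B q \<inter> B r) - prob (B q) * prob (B r))" for q r
  define g where "g q r = 2 * c / sqrt L * (?w q * ?w r * real (gcd q r) / (real q)\<^sup>2)" for q r
  define Z where "Z = {0..<1} - (\<Union>q\<in>{n0..N}. B q)"
  have "prob Z * \<mu>\<^sup>2 \<le> (\<Sum>q=n0..N. \<Sum>r=n0..N. ?w q * ?w r * prob (B q \<inter> B r)) - \<mu>\<^sup>2"
    using second_moment_avoid_le[of "{n0..N}" B ?w] B_ev
    by (simp add: Z_def \<mu>_def M_def space_restrict_space)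
  also have "\<dots> = (\<Sum>q=n0..N. \<Sum>r=n0..N. E q r)"
    unfolding E_def \<mu>_def power2_eq_square sum_product sum_subtractf[symmetric]
    by (simp add: algebra_simps)
  also have "\<dots> \<le> 2 * (\<Sum>q=1..N. \<Sum>r=1..q. g q r)"
  proof (rule sum_sym_le)
    show "g q r \<ge> 0" for q r using c L by (simp add: g_def sqf_weight_nonneg)
    show "E q r = E r q" for q r by (simp add: E_def Int_commute mult_ac)
    fix q r :: nat assume qr: "1 \<le> r" "r \<le> q"
    \<comment> \<open>The main term 4 \<delta>(q) \<delta>(r) of the overlap equals the product of
      the two probabilities and cancels; only the gcd term is left.\<close>
    have "E q r \<le> ?w q * ?w r * (2 * \<delta> q * (real (gcd q r) / real q))"
      unfolding E_def using prob_BB[of q r] qr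
      by (intro mult_left_mono) (auto simp: prob_B sqf_weight_nonneg algebra_simps)
    also have "\<dots> = g q r" by (simp add: g_def \<delta>_def power2_eq_square mult_ac)
    finally show "E q r \<le> g q r" .
  qed (fact n0)
  also have "(\<Sum>q=1..N. \<Sum>r=1..q. g q r)
      = 2 * c / sqrt L * (\<Sum>q=1..N. \<Sum>r=1..q. ?w q * ?w r * real (gcd q r) / (real q)\<^sup>2)"
    by (simp add: g_def sum_distrib_left)
  also have "\<dots> \<le> 2 * c / sqrt L * ((1 + 4 * L) powr (1 / 4) * (1 + 8 * ln (1 + 2 * L)))"
  proof (rule mult_left_mono)
    \<comment> \<open>Halving the logarithm of G^2 <= 1 + 2 L turns the constant 16 of
      \<open>logsum_weight_sum_le\<close> into 8.\<close>
    have "ln (?G N) \<le> ln (1 + 2 * L) / 2"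
    proof -
      have G1: "?G N \<ge> 1" using N by (intro logsum_sqf_weight_ge_1) simp
      then have "2 * ln (?G N) = ln ((?G N)\<^sup>2)" by (simp add: ln_realpow)
      also have "\<dots> \<le> ln (1 + 2 * L)"
        using logsum_sqf_weight_square_upper[of N] N G1 by (intro ln_mono) (auto simp: L_def)
      finally show ?thesis by simp
    qed
    then have "logsum (\<lambda>n. ?w n * (weight_sum n / real n)) N \<le> 1 + 8 * ln (1 + 2 * L)"
      using logsum_weight_sum_le[of N] N by simp
    moreover have "logsum (\<lambda>n. (?w n)\<^sup>2) N \<le> (1 + 4 * L) powr (1 / 4)"
      unfolding L_def by (rule logsum_sqf_weight_square_le) (use N in simp)
    moreover have "logsum (\<lambda>n. ?w n * (weight_sum n / real n)) N \<ge> 0"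
      by (intro logsum_nonneg mult_nonneg_nonneg divide_nonneg_nonneg sqf_weight_nonneg weight_sum_nonneg) simp
    ultimately have "logsum (\<lambda>n. (?w n)\<^sup>2) N * logsum (\<lambda>n. ?w n * (weight_sum n / real n)) N
        \<le> (1 + 4 * L) powr (1 / 4) * (1 + 8 * ln (1 + 2 * L))"
      by (intro mult_mono) auto
    then show "(\<Sum>q=1..N. \<Sum>r=1..q. ?w q * ?w r * real (gcd q r) / (real q)\<^sup>2)
        \<le> (1 + 4 * L) powr (1 / 4) * (1 + 8 * ln (1 + 2 * L))"
      using gcd_sum_le[of N] N by linarith
  qed (use c L in simp)
  finally have upper: "prob Z * \<mu>\<^sup>2 \<le> 4 * c * ((1 + 4 * L) powr (1 / 4) * (1 + 8 * ln (1 + 2 * L)) / sqrt L)"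
    by simp
  have cancel: "prob Z \<le> 8 / c * X" if "prob Z * (c\<^sup>2 / 2) \<le> 4 * c * X" for X
    using that c by (simp add: field_simps power2_eq_square)
  have "prob Z * (c\<^sup>2 / 2) \<le> prob Z * \<mu>\<^sup>2" by (intro mult_left_mono \<mu>_ge) simp
  also note upper
  finally have "prob Z \<le> 8 / c * ((1 + 4 * L) powr (1 / 4) * (1 + 8 * ln (1 + 2 * L)) / sqrt L)"
    by (rule cancel)
  moreover have "prob Z = measure lborel Z" by (rule prob_eq) (auto simp: Z_def)
  ultimately show ?thesis by (simp add: Z_def B_def \<delta>_def L_def)
qed

section \<open>Passage to infinitely many solutions\<close>

lemma approx_set_mono: "\<delta> \<le> \<eta> \<Longrightarrow> approx_set q \<gamma> \<delta> \<subseteq> approx_set q \<gamma> \<eta>"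
  by (auto simp: approx_set_def)

text \<open>For q <= N one has log q <= ln N once N >= 3, so the sets with constant ln N are
  contained in those of \<psi>. The avoided tail therefore has measure at most the error for every
  large N, and that error, of order L^(-1/4) ln L, tends to 0.\<close>

lemma measure_avoid_tail:
  assumes c: "c > 0" and \<psi>: "\<And>q. q \<ge> 1 \<Longrightarrow> c / (real q * sqrt (tlog (real q))) \<le> \<psi> q" and n0: "n0 \<ge> 1"
  shows "measure lborel ({0..<1} - (\<Union>q\<in>{n0..}. approx_set q (\<gamma> q) (\<psi> q))) = 0"
proof -
  \<comment> \<open>Shrinking c to at most 1/2 only shrinks the sets and meets the hypothesis of
    \<open>measure_avoid_le\<close>.\<close>
  define c' where "c' = min c (1 / 2)"
  have c': "0 < c'" "c' \<le> 1 / 2" "c' \<le> c" using c by (auto simp: c'_def)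
  let ?Z = "{0..<1} - (\<Union>q\<in>{n0..}. approx_set q (\<gamma> q) (\<psi> q))"
  let ?e = "\<lambda>N::nat. 8 / c' * ((1 + 4 * ln (real N)) powr (1 / 4) * (1 + 8 * ln (1 + 2 * ln (real N))) / sqrt (ln (real N)))"
  have "(\<lambda>N::nat. (1 + 4 * ln (real N)) powr (1 / 4) * (1 + 8 * ln (1 + 2 * ln (real N))) / sqrt (ln (real N))) \<longlonglongrightarrow> 0"
    by real_asymp
  then have "?e \<longlonglongrightarrow> 0" by (rule tendsto_mult_right_zero)
  moreover have "\<forall>\<^sub>F N in sequentially. measure lborel ?Z \<le> ?e N"
    using eventually_ge_at_top[of 3]
      filterlim_at_top[THEN iffD1, OF logsum_sqf_weight_at_top, rule_format, of "2 * logsum sqf_weight (n0 - 1)"]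
  proof eventually_elim
    case (elim N)
    let ?A = "\<lambda>q. approx_set q (\<gamma> q) (c' / (real q * sqrt (ln (real N))))"
    have "approx_set q (\<gamma> q) (\<psi> q) \<supseteq> ?A q" if q: "q \<in> {n0..N}" for q
    proof (rule approx_set_mono)
      have "exp 1 \<le> real N" using exp_le elim by simp
      then have ln1: "1 \<le> ln (real N)" using elim by (subst ln_ge_iff) auto
      have "tlog (real q) \<le> tlog (real N)" using q n0 by (intro tlog_mono) auto
      then have "tlog (real q) \<le> ln (real N)" using ln1 by (simp add: tlog_def)
      then have "real q * sqrt (tlog (real q)) \<le> real q * sqrt (ln (real N))"
        by (intro mult_left_mono) auto
      moreover have "0 < real q * sqrt (tlog (real q))"
        using q n0 tlog_ge_1[of "real q"] by (intro mult_pos_pos) auto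
      ultimately have "c' / (real q * sqrt (ln (real N))) \<le> c / (real q * sqrt (tlog (real q)))"
        using c c' by (intro frac_le) auto
      then show "c' / (real q * sqrt (ln (real N))) \<le> \<psi> q"
        using \<psi>[of q] q n0 by auto
    qed
    then have "(\<Union>q\<in>{n0..N}. ?A q) \<subseteq> (\<Union>q\<in>{n0..}. approx_set q (\<gamma> q) (\<psi> q))"
      by (intro UN_mono) auto
    then have sub: "?Z \<subseteq> {0..<1} - (\<Union>q\<in>{n0..N}. ?A q)" by (rule Diff_mono[OF order.refl])
    have "measure lborel ?Z \<le> measure lborel ({0..<1} - (\<Union>q\<in>{n0..N}. ?A q))"
    proof (rule measure_mono_fmeasurable[OF sub])
      show "{0..<1} - (\<Union>q\<in>{n0..N}. ?A q) \<in> fmeasurable lborel"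
        by (intro fmeasurable_Diff) (auto simp: fmeasurable_def)
    qed auto
    also have "\<dots> \<le> ?e N" by (rule measure_avoid_le) (use c' n0 elim in auto)
    finally show ?case .
  qed
  ultimately have "measure lborel ?Z \<le> 0"
    by (intro tendsto_le[OF _ _ tendsto_const]) auto
  then show ?thesis using measure_nonneg[of lborel ?Z] by linarith
qed

text \<open>A point of [0, 1) outside \<open>W\<close> has a last solution n, hence lies in the null
  set \<open>Z n\<close>; the only other candidate is the endpoint 1. Measurability of
  \<open>W\<close> comes with this, since its complement in [0, 1] is Lebesgue null.\<close>

lemma emeasure_W_eq_1:
  assumes "c > 0" and "\<And>q. q \<ge> 1 \<Longrightarrow> c / (real q * sqrt (tlog (real q))) \<le> \<psi> q"
  shows "emeasure lebesgue (W \<psi> \<gamma>) = 1"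
proof -
  \<comment> \<open>\<open>Suc n\<close> keeps out the index 0, where no bound on \<psi> is
    available.\<close>
  define Z where "Z n = {0..<1} - (\<Union>q\<in>{Suc n..}. approx_set q (\<gamma> q) (\<psi> q))" for n
  have Z_borel: "Z n \<in> sets lborel" for n
    unfolding Z_def by (intro sets.Diff sets.countable_UN') auto
  have "Z n \<in> null_sets lborel" for n
  proof (rule null_setsI)
    have "emeasure lborel (Z n) \<le> emeasure lborel {0..<1::real}"
      by (rule emeasure_mono) (auto simp: Z_def)
    then have "emeasure lborel (Z n) \<noteq> \<infinity>" by (auto simp: top_unique)
    then have "emeasure lborel (Z n) = ennreal (measure lborel (Z n))"
      by (simp add: emeasure_eq_ennreal_measure)
    then show "emeasure lborel (Z n) = 0"
      using measure_avoid_tail[OF assms, of "Suc n"] by (simp add: Z_def)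
  qed (rule Z_borel)
  then have "(\<Union>n. Z n) \<union> {1} \<in> null_sets lborel"
    by (intro null_sets.Un null_sets_UN) (auto intro: null_setsI)
  \<comment> \<open>In the completion every subset of this Borel null set is null as well.\<close>
  then have "negligible ((\<Union>n. Z n) \<union> {1})"
    unfolding negligible_iff_null_sets by (rule null_sets_completionI)
  moreover have "{0..1} - W \<psi> \<gamma> \<subseteq> (\<Union>n. Z n) \<union> {1}"
  proof
    fix \<alpha> assume \<alpha>: "\<alpha> \<in> {0..1} - W \<psi> \<gamma>"
    let ?S = "{q. 1 \<le> q \<and> dist_int (real q * \<alpha> - \<gamma> q) < \<psi> q}"
    have "finite ?S" using \<alpha> by (auto simp: W_def)
    then obtain n where n: "\<And>q. q \<in> ?S \<Longrightarrow> q \<le> n" by (meson finite_nat_set_iff_bounded_le)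
    have "\<alpha> \<in> Z n" if "\<alpha> \<noteq> 1"
    proof -
      have "\<alpha> \<notin> approx_set q (\<gamma> q) (\<psi> q)" if "q \<ge> Suc n" for q
        using n[of q] that by (auto simp: approx_set_def)
      then show ?thesis using \<alpha> that by (auto simp: Z_def)
    qed
    then show "\<alpha> \<in> (\<Union>n. Z n) \<union> {1}" by blast
  qed
  ultimately have "{0..1} - W \<psi> \<gamma> \<in> null_sets lebesgue"
    using negligible_subset negligible_iff_null_sets by blast
  then have "emeasure lebesgue ({0..1} - ({0..1} - W \<psi> \<gamma>)) = emeasure lebesgue {0..1::real}"
    by (intro emeasure_Diff_null_set) auto
  moreover have "{0..1} - ({0..1} - W \<psi> \<gamma>) = W \<psi> \<gamma>" by (auto simp: W_def)
  ultimately show ?thesis by simp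
qed

theorem corollary2:
  shows "(\<forall>\<psi> :: nat \<Rightarrow> real.
            (\<forall>q\<ge>1. 0 \<le> \<psi> q) \<longrightarrow>
            (\<forall>q\<ge>1. \<psi> (q + 1) \<le> \<psi> q) \<longrightarrow>
            (\<exists>(\<epsilon>::real) (k::nat) (c::real). \<epsilon> > 0 \<and> k \<ge> 2 \<and> c > 0 \<and>
               (\<forall>q\<ge>1. \<psi> q \<ge> c * (((tlog ^^ k) (real q)) powr \<epsilon> / (real q * sqrt (tlog (real q)))))) \<longrightarrow>
            (\<forall>\<gamma> :: nat \<Rightarrow> real. emeasure lebesgue (W \<psi> \<gamma>) = 1))
       \<and> (\<forall>\<gamma> :: nat \<Rightarrow> real. emeasure lebesgue (W (\<lambda>q. 1 / real q) \<gamma>) = 1)"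
proof (intro conjI allI impI)
  fix \<psi> \<gamma> :: "nat \<Rightarrow> real"
  assume "\<exists>(\<epsilon>::real) (k::nat) (c::real). \<epsilon> > 0 \<and> k \<ge> 2 \<and> c > 0 \<and>
    (\<forall>q\<ge>1. \<psi> q \<ge> c * (((tlog ^^ k) (real q)) powr \<epsilon> / (real q * sqrt (tlog (real q)))))"
  then obtain \<epsilon> c :: real and k :: nat where c: "\<epsilon> > 0" "k \<ge> 2" "c > 0"
    and \<psi>: "\<And>q. q \<ge> 1 \<Longrightarrow> \<psi> q \<ge> c * (((tlog ^^ k) (real q)) powr \<epsilon> / (real q * sqrt (tlog (real q))))"
    by blast
  show "emeasure lebesgue (W \<psi> \<gamma>) = 1"
  proof (rule emeasure_W_eq_1[OF c(3)])
    fix q :: nat assume q: "q \<ge> 1"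
    have "1 \<le> (tlog ^^ k) (real q) powr \<epsilon>"
      using c iter_tlog_ge_1[of k "real q"] by (intro ge_one_powr_ge_zero) auto
    then have "c * (1 / (real q * sqrt (tlog (real q))))
        \<le> c * ((tlog ^^ k) (real q) powr \<epsilon> / (real q * sqrt (tlog (real q))))"
      using c tlog_ge_1[of "real q"] by (intro mult_left_mono divide_right_mono) auto
    then show "c / (real q * sqrt (tlog (real q))) \<le> \<psi> q" using \<psi>[OF q] by simp
  qed
next
  fix \<gamma> :: "nat \<Rightarrow> real"
  show "emeasure lebesgue (W (\<lambda>q. 1 / real q) \<gamma>) = 1"
  proof (rule emeasure_W_eq_1[of 1])
    fix q :: nat assume "q \<ge> 1"
    then have "real q * 1 \<le> real q * sqrt (tlog (real q))"
      using tlog_ge_1[of "real q"] by (intro mult_left_mono) auto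
    then show "1 / (real q * sqrt (tlog (real q))) \<le> 1 / real q"
      using \<open>q \<ge> 1\<close> by (intro divide_left_mono) auto
  qed simp
qed

end
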